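(* Let $n\ge2$, let $A$ be an associative unital algebra over a commutative ring $k$, and let $\rho\in A\otimes A$ be an invertible solution to the algebraic Yang-Baxter equation. Then the assignment $$Rep(\mu_{ij})=\tilde\rho_{ij}\ (1\le i\neq j\le n),\qquad Rep(v_i)=P_i\ (1\le i\le n-1)$$ defines a representation $Rep:VB_n\to \mathrm{Aut}(A^{\otimes n})$ of the virtual braid group, i.e. a group homomorphism onto a subgroup of the group $\mathrm{Aut}(A^{\otimes n})$ of $k$-linear automorphisms of $A^{\otimes n}$.
   Context: Tensor products are over $k$. Write $\rho=\sum e\otimes e'$ (a finite sum, summation index suppressed). For $r\ne s$, $\rho_{rs}\in A^{\otimes n}$ is the sum of the tensors having $e$ in the $r$-th factor, $e'$ in the $s$-th factor, and $1_A$ elsewhere. The element $\rho$ is a solution to the algebraic Yang-Baxter equation if $\rho_{12}\rho_{13}\rho_{23}=\rho_{23}\rho_{13}\rho_{12}$ in $A^{\otimes3}$. Define $\tilde\rho_{ij}:A^{\otimes n}\to A^{\otimes n}$ by $\tilde\rho_{ij}(\alpha)=\rho_{ij}\alpha$ (left multiplication), and let $P_i=P_{i,i+1}:A^{\otimes n}\to A^{\otimes n}$ interchange the $i$-th and $(i+1)$-st tensor factors. The product in $\mathrm{Aut}(A^{\otimes n})$ is composition. The virtual braid group $VB_n$ is taken in its stringy presentation: generators $\mu_{ij}$ ($1\le i\ne j\le n$) and $v_1,\dots,v_{n-1}$; relations $v_iv_{i+1}v_i=v_{i+1}v_iv_{i+1}$, $v_iv_j=v_jv_i$ for $|i-j|>1$,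 $v_i^2=1$; $\tau\mu_{ij}\tau^{-1}=\mu_{\tau(i),\tau(j)}$ for all $\tau\in S_n$ (with $\tau$ written as a word in the $v_i$, $v_i$ standing for the transposition $(i,i+1)$, permutations composed as functions); $\mu_{12}\mu_{13}\mu_{23}=\mu_{23}\mu_{13}\mu_{12}$ (if $n\geq 3$); $\mu_{12}\mu_{34}=\mu_{34}\mu_{12}$ (if $n\ge4$). *)

theory Defs
  imports "HOL-Algebra.Module" "HOL-Algebra.QuotRing" "HOL-Algebra.Bij"
    "HOL-Combinatorics.Transposition"
begin

section \<open>Associative unital algebras over a commutative ring\<close>

text \<open>The locale \<open>algebra\<close> of the library is restricted to commutative algebras.\<close>

locale assoc_algebra = module + ring M +
  assumes smult_mult_left:
      "\<lbrakk>a \<in> carrier R; x \<in> carrier M; y \<in> carrier M\<rbrakk> \<Longrightarrow>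
        (a \<odot>\<^bsub>M\<^esub> x) \<otimes>\<^bsub>M\<^esub> y = a \<odot>\<^bsub>M\<^esub> (x \<otimes>\<^bsub>M\<^esub> y)"
    and smult_mult_right:
      "\<lbrakk>a \<in> carrier R; x \<in> carrier M; y \<in> carrier M\<rbrakk> \<Longrightarrow>
        x \<otimes>\<^bsub>M\<^esub> (a \<odot>\<^bsub>M\<^esub> y) = a \<odot>\<^bsub>M\<^esub> (x \<otimes>\<^bsub>M\<^esub> y)"

definition module_aut_group ::
    "('k, 'r) ring_scheme \<Rightarrow> ('k, 'b, 'm) module_scheme \<Rightarrow> ('b \<Rightarrow> 'b) monoid" where
  "module_aut_group k M = AutoGroup (add_monoid M)
     \<lparr>carrier := {f \<in> auto (add_monoid M).
        \<forall>c \<in> carrier k. \<forall>x \<in> carrier M. f (c \<odot>\<^bsub>M\<^esub> x) = c \<odot>\<^bsub>M\<^esub> f x}\<rparr>"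


section \<open>Tensor powers of an algebra\<close>

text \<open>
  The \<open>n\<close>-th tensor power is the free \<open>k\<close>-module on the set of \<open>n\<close>-tuples of elements of \<open>A\<close>,
  modulo the submodule generated by the multilinearity relations. Tuples are indexed by \<open>{1..n}\<close>.
  On the free module, the product is the bilinear extension of the componentwise product of tuples
  (it is the monoid algebra of the multiplicative monoid of \<open>n\<close>-tuples). The submodule of relations
  is a two-sided ideal for this product, so that the quotient product is determined by
  \<open>(a\<^sub>1 \<otimes> \<dots> \<otimes> a\<^sub>n) (b\<^sub>1 \<otimes> \<dots> \<otimes> b\<^sub>n) = a\<^sub>1 b\<^sub>1 \<otimes> \<dots> \<otimes> a\<^sub>n b\<^sub>n\<close>.
\<close>

definition tuples :: "('a, 'm) ring_scheme \<Rightarrow> nat \<Rightarrow> (nat \<Rightarrow> 'a) set" where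
  "tuples A n = {1..n} \<rightarrow>\<^sub>E carrier A"

definition single :: "('k, 'r) ring_scheme \<Rightarrow> 'x \<Rightarrow> 'x \<Rightarrow> 'k" where
  "single k x = (\<lambda>y. if y = x then \<one>\<^bsub>k\<^esub> else \<zero>\<^bsub>k\<^esub>)"

definition free_tensor ::
    "('k, 'r) ring_scheme \<Rightarrow> ('a, 'm) ring_scheme \<Rightarrow> nat \<Rightarrow> ('k, (nat \<Rightarrow> 'a) \<Rightarrow> 'k) module" where
  "free_tensor k A n =
     \<lparr>carrier = {f. (\<forall>x. f x \<in> carrier k) \<and>
                   {x. f x \<noteq> \<zero>\<^bsub>k\<^esub>} \<subseteq> tuples A n \<and> finite {x. f x \<noteq> \<zero>\<^bsub>k\<^esub>}},
      mult = \<lambda>f g z. \<Oplus>\<^bsub>k\<^esub>p \<in> {(x, y). f x \<noteq> \<zero>\<^bsub>k\<^esub> \<and> g y \<noteq> \<zero>\<^bsub>k\<^esub> \<and>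
                                   (\<lambda>i\<in>{1..n}. x i \<otimes>\<^bsub>A\<^esub> y i) = z}.
                        f (fst p) \<otimes>\<^bsub>k\<^esub> g (snd p),
      one = single k (\<lambda>i\<in>{1..n}. \<one>\<^bsub>A\<^esub>),
      zero = \<lambda>_. \<zero>\<^bsub>k\<^esub>,
      add = \<lambda>f g x. f x \<oplus>\<^bsub>k\<^esub> g x,
      smult = \<lambda>c f x. c \<otimes>\<^bsub>k\<^esub> f x\<rparr>"

definition multilinear_relators ::
    "('k, 'r) ring_scheme \<Rightarrow> ('k, 'a, 'm) module_scheme \<Rightarrow> nat \<Rightarrow> ((nat \<Rightarrow> 'a) \<Rightarrow> 'k) set" where
  "multilinear_relators k A n =
     (let F = free_tensor k A n in
       {single k (x(i := a \<oplus>\<^bsub>A\<^esub> b)) \<ominus>\<^bsub>F\<^esub> (single k (x(i := a)) \<oplus>\<^bsub>F\<^esub> single k (x(i := b))) |x i a b.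
          x \<in> tuples A n \<and> i \<in> {1..n} \<and> a \<in> carrier A \<and> b \<in> carrier A} \<union>
       {single k (x(i := c \<odot>\<^bsub>A\<^esub> a)) \<ominus>\<^bsub>F\<^esub> (c \<odot>\<^bsub>F\<^esub> single k (x(i := a))) |x i c a.
          x \<in> tuples A n \<and> i \<in> {1..n} \<and> c \<in> carrier k \<and> a \<in> carrier A})"

definition tensor_ideal ::
    "('k, 'r) ring_scheme \<Rightarrow> ('k, 'a, 'm) module_scheme \<Rightarrow> nat \<Rightarrow> ((nat \<Rightarrow> 'a) \<Rightarrow> 'k) set" where
  "tensor_ideal k A n =
     \<Inter>{N. submodule N k (free_tensor k A n) \<and> multilinear_relators k A n \<subseteq> N}"

definition tensor_power ::
    "('k, 'r) ring_scheme \<Rightarrow> ('k, 'a, 'm) module_scheme \<Rightarrow> nat \<Rightarrow>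
     ('k, ((nat \<Rightarrow> 'a) \<Rightarrow> 'k) set) module" where
  "tensor_power k A n =
     (let F = free_tensor k A n; I = tensor_ideal k A n; Q = F Quot I in
       \<lparr>carrier = carrier Q, mult = mult Q, one = one Q, zero = zero Q, add = add Q,
        smult = \<lambda>c X. \<Union>f\<in>X. I +>\<^bsub>F\<^esub> (c \<odot>\<^bsub>F\<^esub> f)\<rparr>)"

text \<open>
  For a map \<open>\<phi>\<close> from \<open>m\<close>-tuples to \<open>n\<close>-tuples that respects the multilinearity relations,
  \<open>tensor_map k A m n \<phi>\<close> is the induced linear map
  \<open>\<Sum> c\<^sub>x (x\<^sub>1 \<otimes> \<dots> \<otimes> x\<^sub>m) \<mapsto> \<Sum> c\<^sub>x (\<phi>(x)\<^sub>1 \<otimes> \<dots> \<otimes> \<phi>(x)\<^sub>n)\<close>. The union below is over all representatives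
  \<open>f\<close> of the class \<open>X\<close>; they all give the same class.
\<close>

definition push_forward ::
    "('k, 'r) ring_scheme \<Rightarrow> ('x \<Rightarrow> 'y) \<Rightarrow> ('x \<Rightarrow> 'k) \<Rightarrow> ('y \<Rightarrow> 'k)" where
  "push_forward k \<phi> f = (\<lambda>y. \<Oplus>\<^bsub>k\<^esub>x \<in> {x. f x \<noteq> \<zero>\<^bsub>k\<^esub> \<and> \<phi> x = y}. f x)"

definition tensor_map ::
    "('k, 'r) ring_scheme \<Rightarrow> ('k, 'a, 'm) module_scheme \<Rightarrow> nat \<Rightarrow> nat \<Rightarrow>
     ((nat \<Rightarrow> 'a) \<Rightarrow> (nat \<Rightarrow> 'a)) \<Rightarrow> ((nat \<Rightarrow> 'a) \<Rightarrow> 'k) set \<Rightarrow> ((nat \<Rightarrow> 'a) \<Rightarrow> 'k) set" where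
  "tensor_map k A m n \<phi> =
     (\<lambda>X \<in> carrier (tensor_power k A m).
        \<Union>f\<in>X. tensor_ideal k A n +>\<^bsub>free_tensor k A n\<^esub> push_forward k \<phi> f)"

definition tensor_leg ::
    "('k, 'r) ring_scheme \<Rightarrow> ('k, 'a, 'm) module_scheme \<Rightarrow> nat \<Rightarrow> nat \<Rightarrow> nat \<Rightarrow>
     ((nat \<Rightarrow> 'a) \<Rightarrow> 'k) set \<Rightarrow> ((nat \<Rightarrow> 'a) \<Rightarrow> 'k) set" where
  "tensor_leg k A n r s =
     tensor_map k A 2 n
       (\<lambda>x. \<lambda>i\<in>{1..n}. if i = r then x 1 else if i = s then x 2 else \<one>\<^bsub>A\<^esub>)"

definition tensor_swap ::
    "('k, 'r) ring_scheme \<Rightarrow> ('k, 'a, 'm) module_scheme \<Rightarrow> nat \<Rightarrow> nat \<Rightarrow>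
     ((nat \<Rightarrow> 'a) \<Rightarrow> 'k) set \<Rightarrow> ((nat \<Rightarrow> 'a) \<Rightarrow> 'k) set" where
  "tensor_swap k A n i =
     tensor_map k A n n (\<lambda>x. \<lambda>j\<in>{1..n}. x (Transposition.transpose i (i + 1) j))"

definition leg_mult ::
    "('k, 'r) ring_scheme \<Rightarrow> ('k, 'a, 'm) module_scheme \<Rightarrow> nat \<Rightarrow> ((nat \<Rightarrow> 'a) \<Rightarrow> 'k) set \<Rightarrow>
     nat \<Rightarrow> nat \<Rightarrow> ((nat \<Rightarrow> 'a) \<Rightarrow> 'k) set \<Rightarrow> ((nat \<Rightarrow> 'a) \<Rightarrow> 'k) set" where
  "leg_mult k A n \<rho> i j =
     (\<lambda>\<alpha> \<in> carrier (tensor_power k A n). tensor_leg k A n i j \<rho> \<otimes>\<^bsub>tensor_power k A n\<^esub> \<alpha>)"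

definition algebraic_YBE ::
    "('k, 'r) ring_scheme \<Rightarrow> ('k, 'a, 'm) module_scheme \<Rightarrow> ((nat \<Rightarrow> 'a) \<Rightarrow> 'k) set \<Rightarrow> bool" where
  "algebraic_YBE k A \<rho> \<longleftrightarrow>
     (let T = tensor_power k A 3; \<rho>' = (\<lambda>r s. tensor_leg k A 3 r s \<rho>) in
       \<rho>' 1 2 \<otimes>\<^bsub>T\<^esub> \<rho>' 1 3 \<otimes>\<^bsub>T\<^esub> \<rho>' 2 3 = \<rho>' 2 3 \<otimes>\<^bsub>T\<^esub> \<rho>' 1 3 \<otimes>\<^bsub>T\<^esub> \<rho>' 1 2)"


section \<open>Groups given by generators and relations\<close>

text \<open>The letter \<open>(g, True)\<close> stands for the generator \<open>g\<close>, and \<open>(g, False)\<close> for its inverse.\<close>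

type_synonym 'g word = "('g \<times> bool) list"

definition gen :: "'g \<Rightarrow> 'g \<times> bool" where
  "gen g = (g, True)"

definition inv_word :: "'g word \<Rightarrow> 'g word" where
  "inv_word w = rev (map (\<lambda>(g, b). (g, \<not> b)) w)"

inductive word_eq :: "'g set \<Rightarrow> ('g word \<times> 'g word) set \<Rightarrow> 'g word \<Rightarrow> 'g word \<Rightarrow> bool"
  for S :: "'g set" and rels :: "('g word \<times> 'g word) set"
where
  refl: "w \<in> lists (S \<times> UNIV) \<Longrightarrow> word_eq S rels w w"
| sym: "word_eq S rels u v \<Longrightarrow> word_eq S rels v u"
| trans: "word_eq S rels u v \<Longrightarrow> word_eq S rels v w \<Longrightarrow> word_eq S rels u w"
| append: "word_eq S rels u u' \<Longrightarrow> word_eq S rels v v' \<Longrightarrow> word_eq S rels (u @ v) (u' @ v')"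
| cancel: "g \<in> S \<Longrightarrow> word_eq S rels [(g, b), (g, \<not> b)] []"
| rel: "(u, v) \<in> rels \<Longrightarrow> u \<in> lists (S \<times> UNIV) \<Longrightarrow> v \<in> lists (S \<times> UNIV) \<Longrightarrow> word_eq S rels u v"

definition word_class :: "'g set \<Rightarrow> ('g word \<times> 'g word) set \<Rightarrow> 'g word \<Rightarrow> 'g word set" where
  "word_class S rels w = {w'. word_eq S rels w w'}"

definition presented_group :: "'g set \<Rightarrow> ('g word \<times> 'g word) set \<Rightarrow> 'g word set monoid" where
  "presented_group S rels =
     \<lparr>carrier = word_class S rels ` lists (S \<times> UNIV),
      mult = \<lambda>X Y. \<Union>u\<in>X. \<Union>v\<in>Y. word_class S rels (u @ v),
      one = word_class S rels []\<rparr>"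


section \<open>The virtual braid group\<close>

datatype vb_gen = Mu nat nat | V nat

definition vb_gens :: "nat \<Rightarrow> vb_gen set" where
  "vb_gens n = {Mu i j |i j. i \<in> {1..n} \<and> j \<in> {1..n} \<and> i \<noteq> j} \<union> V ` {1..<n}"

definition v_word :: "nat list \<Rightarrow> vb_gen word" where
  "v_word ws = map (\<lambda>i. gen (V i)) ws"

definition v_perm :: "nat list \<Rightarrow> nat \<Rightarrow> nat" where
  "v_perm ws = foldr (\<lambda>i \<tau>. Transposition.transpose i (i + 1) \<circ> \<tau>) ws id"

text \<open>
  In the conjugation relations, \<open>ws\<close> ranges over all words in the \<open>v\<^sub>i\<close>, so that \<open>v_perm ws\<close> ranges
  over all \<open>\<tau> \<in> S\<^sub>n\<close> and all ways of writing \<open>\<tau>\<close> as such a word.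
\<close>

definition vb_rels :: "nat \<Rightarrow> (vb_gen word \<times> vb_gen word) set" where
  "vb_rels n =
     {([gen (V i), gen (V (i + 1)), gen (V i)], [gen (V (i + 1)), gen (V i), gen (V (i + 1))]) |i.
        1 \<le> i \<and> i + 1 < n} \<union>
     {([gen (V i), gen (V j)], [gen (V j), gen (V i)]) |i j.
        i \<in> {1..<n} \<and> j \<in> {1..<n} \<and> \<bar>int i - int j\<bar> > 1} \<union>
     {([gen (V i), gen (V i)], []) |i. i \<in> {1..<n}} \<union>
     {(v_word ws @ [gen (Mu i j)] @ inv_word (v_word ws), [gen (Mu (v_perm ws i) (v_perm ws j))]) |ws i j.
        ws \<in> lists {1..<n} \<and> i \<in> {1..n} \<and> j \<in> {1..n} \<and> i \<noteq> j} \<union>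
     (if n \<ge> 3 then
       {([gen (Mu 1 2), gen (Mu 1 3), gen (Mu 2 3)], [gen (Mu 2 3), gen (Mu 1 3), gen (Mu 1 2)])}
      else {}) \<union>
     (if n \<ge> 4 then
       {([gen (Mu 1 2), gen (Mu 3 4)], [gen (Mu 3 4), gen (Mu 1 2)])}
      else {})"

definition virtual_braid_group :: "nat \<Rightarrow> vb_gen word set monoid" where
  "virtual_braid_group n = presented_group (vb_gens n) (vb_rels n)"

definition vb_mu :: "nat \<Rightarrow> nat \<Rightarrow> nat \<Rightarrow> vb_gen word set" where
  "vb_mu n i j = word_class (vb_gens n) (vb_rels n) [gen (Mu i j)]"

definition vb_v :: "nat \<Rightarrow> nat \<Rightarrow> vb_gen word set" where
  "vb_v n i = word_class (vb_gens n) (vb_rels n) [gen (V i)]"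

end

theory Submission
  imports Defs
begin

text \<open>
  Every injection \<open>\<sigma>\<close> of \<open>{1..m}\<close> into \<open>{1..n}\<close> induces an algebra homomorphism
  \<open>E\<^sub>\<sigma>\<close> between the tensor powers, functorially in \<open>\<sigma>\<close>. Functoriality turns every relation among the
  \<open>v\<^sub>i\<close> into an equality of permutations, and gives \<open>E\<^sub>\<tau> (\<rho>\<^sub>i\<^sub>j \<alpha>) = \<rho>\<^sub>\<tau>\<^sub>i\<^sub>,\<^sub>\<tau>\<^sub>j E\<^sub>\<tau> \<alpha>\<close>, which is the
  conjugation relation. The Yang-Baxter equation in the \<open>n\<close>-th tensor power is the image of the one in
  the third under the inclusion of the first three slots, and \<open>E\<^sub>\<sigma>\<close>, \<open>E\<^sub>\<tau>\<close> have commuting images when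
  \<open>\<sigma>\<close> and \<open>\<tau>\<close> have disjoint ranges.
\<close>

section \<open>Presented groups\<close>

text \<open>
  Otherwise \<open>auto\<close> replaces membership in \<open>lists\<close> by a statement about \<open>set\<close>, out of reach of the
  lemmas on words below.
\<close>

declare in_listsD [rule del] in_listsI [rule del]

text \<open>The tensor power is a concrete quotient, so a map out of it must be given on
  representatives and shown to respect the multilinearity relations. Two devices keep this cheap.
  The product of the free module and the maps induced by slot injections are all push-forwards of
  finitely supported functions along maps of index sets, hence linear for one common reason;
  identities therefore need checking only on pure tuples (\<open>FT_induct\<close>), where they
  become statements about single slots. And the ideal is the least submodule containing the
  relators, so a linear map respects it as soon as it sends relators to relators
  (\<open>tensor_ideal_image\<close>). On the group side the representation is evaluation of words.
  Words contain inverse letters, so the generators must act invertibly; this is where invertibility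
  of \<open>\<rho>\<close> enters. The conjugation relations range over all words for a permutation
  \<open>\<tau>\<close>; they are treated uniformly because the value of such a word depends on
  \<open>\<tau>\<close> alone (\<open>eval_v_word\<close>).\<close>

lemma word_eq_in_lists:
  "word_eq S rels u v \<Longrightarrow> u \<in> lists (S \<times> UNIV) \<and> v \<in> lists (S \<times> UNIV)"
  by (induction rule: word_eq.induct) auto

lemma word_class_eqI: "word_eq S rels u v \<Longrightarrow> word_class S rels u = word_class S rels v"
  unfolding word_class_def using word_eq.trans[of S rels] word_eq.sym[of S rels u v] by auto

lemma self_in_word_class: "w \<in> lists (S \<times> UNIV) \<Longrightarrow> w \<in> word_class S rels w"
  unfolding word_class_def by (simp add: word_eq.refl)

text \<open>The product of two classes is a union over all pairs of representatives. Since
  \<open>word_eq\<close> is a congruence, every pair contributes the same class, and the union is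
  not empty because each word lies in its own class.\<close>

lemma presented_group_mult:
  assumes "u \<in> lists (S \<times> UNIV)" "v \<in> lists (S \<times> UNIV)"
  shows "word_class S rels u \<otimes>\<^bsub>presented_group S rels\<^esub> word_class S rels v = word_class S rels (u @ v)"
proof -
  have eq: "word_class S rels (u' @ v') = word_class S rels (u @ v)"
    if "u' \<in> word_class S rels u" "v' \<in> word_class S rels v" for u' v'
    using that unfolding word_class_def[of S rels u] word_class_def[of S rels v]
    by (intro word_class_eqI word_eq.append) (simp_all add: word_eq.sym)
  have "(\<Union>u'\<in>word_class S rels u. \<Union>v'\<in>word_class S rels v. word_class S rels (u' @ v'))
      = (\<Union>u'\<in>word_class S rels u. \<Union>v'\<in>word_class S rels v. word_class S rels (u @ v))"
    by (intro SUP_cong eq) simp_all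
  also have "\<dots> = word_class S rels (u @ v)"
    using assms[THEN self_in_word_class, of rels] by blast
  finally show ?thesis by (simp add: presented_group_def)
qed

lemma inv_word_in_lists: "w \<in> lists (S \<times> UNIV) \<Longrightarrow> inv_word w \<in> lists (S \<times> UNIV)"
  by (induction w) (auto simp: inv_word_def)

text \<open>Cancellation starts in the middle: the last letter of \<open>inv_word (l # w)\<close>
  meets \<open>l\<close>, and what is left falls under the induction hypothesis. A left inverse is
  all that \<open>groupI\<close> asks for.\<close>

lemma word_eq_inv_word:
  "w \<in> lists (S \<times> UNIV) \<Longrightarrow> word_eq S rels (inv_word w @ w) []"
proof (induction w)
  case Nil
  then show ?case by (simp add: inv_word_def word_eq.refl)
next
  case (Cons l w)
  obtain g b where l: "l = (g, b)" by (cases l)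
  have w: "w \<in> lists (S \<times> UNIV)" and g: "g \<in> S" using Cons.prems l by auto
  have "word_eq S rels ([(g, \<not> b), (g, b)] @ w) ([] @ w)"
    using word_eq.cancel[OF g, of rels "\<not> b"] w by (intro word_eq.append word_eq.refl) simp_all
  then have "word_eq S rels (inv_word w @ [(g, \<not> b), (g, b)] @ w) (inv_word w @ [] @ w)"
    using inv_word_in_lists[OF w] by (intro word_eq.append[OF word_eq.refl]) simp_all
  also have "inv_word w @ [(g, \<not> b), (g, b)] @ w = inv_word (l # w) @ l # w"
    by (simp add: inv_word_def l)
  finally show ?case by (rule word_eq.trans) (use Cons.IH[OF w] in simp)
qed

lemma presented_group_carrier:
  "carrier (presented_group S rels) = word_class S rels ` lists (S \<times> UNIV)"
  by (simp add: presented_group_def)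

lemma presented_group_one: "\<one>\<^bsub>presented_group S rels\<^esub> = word_class S rels []"
  by (simp add: presented_group_def)

lemma group_presented_group: "group (presented_group S rels)"
proof (rule groupI)
  fix x assume "x \<in> carrier (presented_group S rels)"
  then obtain w where w: "w \<in> lists (S \<times> UNIV)" "x = word_class S rels w"
    by (auto simp: presented_group_carrier)
  show "\<exists>y\<in>carrier (presented_group S rels).
      y \<otimes>\<^bsub>presented_group S rels\<^esub> x = \<one>\<^bsub>presented_group S rels\<^esub>"
  proof
    show "word_class S rels (inv_word w) \<otimes>\<^bsub>presented_group S rels\<^esub> x = \<one>\<^bsub>presented_group S rels\<^esub>"
      using w inv_word_in_lists[OF w(1)] word_class_eqI[OF word_eq_inv_word[OF w(1)]]
      by (simp add: presented_group_mult presented_group_one)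
  qed (use inv_word_in_lists[OF w(1)] in \<open>simp add: presented_group_carrier\<close>)
qed (auto simp: presented_group_carrier presented_group_one presented_group_mult)

section \<open>Evaluation of words in a group and the universal property\<close>

primrec eval_word :: "('h, 'z) monoid_scheme \<Rightarrow> ('g \<Rightarrow> 'h) \<Rightarrow> 'g word \<Rightarrow> 'h" where
  "eval_word H h [] = \<one>\<^bsub>H\<^esub>"
| "eval_word H h (l # w) =
     (if snd l then h (fst l) else inv\<^bsub>H\<^esub> h (fst l)) \<otimes>\<^bsub>H\<^esub> eval_word H h w"

context group
begin

lemma eval_word_closed:
  assumes "h \<in> S \<rightarrow> carrier G" "w \<in> lists (S \<times> UNIV)"
  shows "eval_word G h w \<in> carrier G"
  using assms(2)
proof (induction w)
  case (Cons l w)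
  then have "h (fst l) \<in> carrier G" using assms(1) by auto
  then show ?case using Cons.IH by simp
qed simp

lemma eval_word_append:
  assumes "h \<in> S \<rightarrow> carrier G" "u \<in> lists (S \<times> UNIV)" "v \<in> lists (S \<times> UNIV)"
  shows "eval_word G h (u @ v) = eval_word G h u \<otimes> eval_word G h v"
  using assms(2)
proof (induction u)
  case Nil
  then show ?case using eval_word_closed[OF assms(1,3)] by simp
next
  case (Cons l u)
  then have "h (fst l) \<in> carrier G" "u \<in> lists (S \<times> UNIV)" using assms(1) by auto
  then show ?case using Cons.IH eval_word_closed[OF assms(1,3)] eval_word_closed[OF assms(1), of u]
    by (simp add: m_assoc)
qed

text \<open>Every rule generating \<open>word_eq\<close> is a law of groups, except
  \<open>rel\<close>, which is the hypothesis. In the \<open>append\<close> case the membership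
  facts from \<open>word_eq_in_lists\<close> allow evaluation to be split.\<close>

lemma eval_word_eq:
  assumes h: "h \<in> S \<rightarrow> carrier G"
    and rels: "\<And>u v. (u, v) \<in> rels \<Longrightarrow> u \<in> lists (S \<times> UNIV) \<Longrightarrow> v \<in> lists (S \<times> UNIV) \<Longrightarrow>
      eval_word G h u = eval_word G h v"
    and uv: "word_eq S rels u v"
  shows "eval_word G h u = eval_word G h v"
  using uv
proof (induction rule: word_eq.induct)
  case (append u u' v v')
  then show ?case
    using word_eq_in_lists[OF append.hyps(1)] word_eq_in_lists[OF append.hyps(2)]
    by (simp add: eval_word_append[OF h])
next
  case (cancel g b)
  then have "h g \<in> carrier G" using h by auto
  then show ?case by simp
qed (auto intro: rels)

lemma eval_word_inv_word:
  assumes h: "h \<in> S \<rightarrow> carrier G" and w: "w \<in> lists (S \<times> UNIV)"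
  shows "eval_word G h (inv_word w) = inv (eval_word G h w)"
proof (rule inv_equality[symmetric])
  \<comment> \<open>An inverse word cancels by free reduction alone, so the relation set left open
    here may be taken empty.\<close>
  have "eval_word G h (inv_word w @ w) = eval_word G h []"
    by (rule eval_word_eq[OF h _ word_eq_inv_word[OF w]]) auto
  then show "eval_word G h (inv_word w) \<otimes> eval_word G h w = \<one>"
    by (simp add: eval_word_append[OF h inv_word_in_lists[OF w] w])
qed (use eval_word_closed[OF h] w inv_word_in_lists[OF w] in auto)

text \<open>The uniqueness half of the universal property. Homomorphisms preserve inverses, so the
  values on the letters \<open>(g, True)\<close> force those on \<open>(g, False)\<close>, and every
  class is a product of classes of letters.\<close>

lemma hom_presented_group_word_class:
  assumes f: "group_hom (presented_group S rels) G f"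
    and h: "\<And>g. g \<in> S \<Longrightarrow> f (word_class S rels [gen g]) = h g"
    and w: "w \<in> lists (S \<times> UNIV)"
  shows "f (word_class S rels w) = eval_word G h w"
  using w
proof (induction w)
  case Nil
  then show ?case
    using group_hom.hom_one[OF f] by (simp add: presented_group_one)
next
  case (Cons l w)
  interpret f: group_hom "presented_group S rels" G f by (fact f)
  obtain g b where l: "l = (g, b)" by (cases l)
  have w: "w \<in> lists (S \<times> UNIV)" and g: "g \<in> S" using Cons.hyps l by auto
  let ?c = "word_class S rels"
  have mem: "?c [(g, b)] \<in> carrier (presented_group S rels)" for b
    using g by (auto simp: presented_group_carrier)
  have "f (?c [(g, False)]) = inv (f (?c [(g, True)]))"
  proof (rule inv_equality[symmetric])
    have "?c ([(g, False)] @ [(g, True)]) = ?c []"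
      using word_eq.cancel[OF g, of rels False] by (intro word_class_eqI) simp
    then have "?c [(g, False)] \<otimes>\<^bsub>presented_group S rels\<^esub> ?c [(g, True)] = \<one>\<^bsub>presented_group S rels\<^esub>"
      using g by (subst presented_group_mult) (auto simp: presented_group_one)
    then show "f (?c [(g, False)]) \<otimes> f (?c [(g, True)]) = \<one>"
      using mem by (simp flip: f.hom_mult)
  qed (use mem in auto)
  then have letter: "f (?c [(g, b)]) = (if b then h g else inv h g)"
    using h[OF g] by (cases b) (auto simp: gen_def)
  have "?c (l # w) = ?c [(g, b)] \<otimes>\<^bsub>presented_group S rels\<^esub> ?c w"
    using g w by (subst presented_group_mult) (auto simp: l)
  then have "f (?c (l # w)) = f (?c [(g, b)]) \<otimes> f (?c w)"
    using mem w by (simp add: presented_group_carrier)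
  then show ?case using letter Cons.IH w l by simp
qed

text \<open>Von Dyck's theorem. Functions are total, so uniqueness can only be asked among those
  with a prescribed value outside the carrier; this is the purpose of
  \<open>extensional\<close>.\<close>

proposition presented_group_universal:
  assumes h: "h \<in> S \<rightarrow> carrier G"
    and rels: "\<And>u v. (u, v) \<in> rels \<Longrightarrow> u \<in> lists (S \<times> UNIV) \<Longrightarrow> v \<in> lists (S \<times> UNIV) \<Longrightarrow>
      eval_word G h u = eval_word G h v"
  shows "\<exists>!f. f \<in> extensional (carrier (presented_group S rels)) \<and>
           group_hom (presented_group S rels) G f \<and>
           (\<forall>g\<in>S. f (word_class S rels [gen g]) = h g)"
proof -
  let ?P = "presented_group S rels" and ?c = "word_class S rels"
  \<comment> \<open>Any representative serves: by \<open>eval_word_eq\<close> all words in a class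
    have the same value.\<close>
  define f where "f = (\<lambda>X\<in>carrier ?P. eval_word G h (SOME w. w \<in> X))"
  have f: "f (?c w) = eval_word G h w" if w: "w \<in> lists (S \<times> UNIV)" for w
  proof -
    have "(SOME w'. w' \<in> ?c w) \<in> ?c w"
      using self_in_word_class[OF w] by (rule someI)
    then have "eval_word G h w = eval_word G h (SOME w'. w' \<in> ?c w)"
      by (intro eval_word_eq[OF h rels]) (auto simp: word_class_def)
    then show ?thesis using w by (simp add: f_def presented_group_carrier)
  qed
  have "group_hom ?P G f"
  proof (intro group_hom.intro group_hom_axioms.intro homI group_presented_group is_group)
    fix X Y assume "X \<in> carrier ?P" "Y \<in> carrier ?P"
    then obtain u v where uv: "X = ?c u" "Y = ?c v" "u \<in> lists (S \<times> UNIV)" "v \<in> lists (S \<times> UNIV)"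
      by (auto simp: presented_group_carrier)
    then have "u @ v \<in> lists (S \<times> UNIV)" by simp
    from f[OF this] show "f (X \<otimes>\<^bsub>?P\<^esub> Y) = f X \<otimes> f Y"
      using uv by (simp add: presented_group_mult f eval_word_append[OF h])
  qed (auto simp: presented_group_carrier f intro: eval_word_closed[OF h])
  moreover have "f (?c [gen g]) = h g" if "g \<in> S" for g
  proof -
    have "h g \<in> carrier G" using that h by auto
    then show ?thesis using that f[of "[gen g]"] by (simp add: gen_def)
  qed
  ultimately have ex: "f \<in> extensional (carrier ?P) \<and> group_hom ?P G f \<and> (\<forall>g\<in>S. f (?c [gen g]) = h g)"
    by (simp add: f_def)
  show ?thesis
  proof (rule ex1I, rule ex, elim conjE)
    fix f' assume ext: "f' \<in> extensional (carrier ?P)" and hom: "group_hom ?P G f'"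
      and gens: "\<forall>g\<in>S. f' (?c [gen g]) = h g"
    show "f' = f"
    proof (rule extensionalityI[OF ext])
      show "f \<in> extensional (carrier ?P)" by (simp add: f_def)
      fix X assume "X \<in> carrier ?P"
      then obtain w where w: "w \<in> lists (S \<times> UNIV)" "X = ?c w"
        by (auto simp: presented_group_carrier)
      then show "f' X = f X"
        using hom_presented_group_word_class[OF hom _ w(1), of h] gens f[OF w(1)] by simp
    qed
  qed
qed

end

section \<open>The free module on tuples as an algebra\<close>

text \<open>The index type is arbitrary because the product of the free module will be a
  push-forward from pairs of tuples, not from tuples.\<close>

definition fin_supp :: "('k, 'r) ring_scheme \<Rightarrow> ('x \<Rightarrow> 'k) \<Rightarrow> bool" where
  "fin_supp k f \<longleftrightarrow> (\<forall>x. f x \<in> carrier k) \<and> finite {x. f x \<noteq> \<zero>\<^bsub>k\<^esub>}"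

context cring
begin

lemma fin_supp_closed: "fin_supp R f \<Longrightarrow> f x \<in> carrier R"
  by (simp add: fin_supp_def)

lemma fin_supp_add:
  assumes "fin_supp R f" "fin_supp R g"
  shows "fin_supp R (\<lambda>x. f x \<oplus> g x)"
proof -
  have "{x. f x \<oplus> g x \<noteq> \<zero>} \<subseteq> {x. f x \<noteq> \<zero>} \<union> {x. g x \<noteq> \<zero>}" by auto
  then show ?thesis using assms unfolding fin_supp_def by (auto intro: finite_subset)
qed

lemma fin_supp_smult:
  assumes "c \<in> carrier R" "fin_supp R f"
  shows "fin_supp R (\<lambda>x. c \<otimes> f x)"
proof -
  have "{x. c \<otimes> f x \<noteq> \<zero>} \<subseteq> {x. f x \<noteq> \<zero>}" using assms(1) by auto
  then show ?thesis using assms unfolding fin_supp_def by (auto intro: finite_subset)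
qed

lemma fin_supp_times:
  assumes "fin_supp R f" "fin_supp R g"
  shows "fin_supp R (\<lambda>(x, y). f x \<otimes> g y)"
proof -
  have "{p. (case p of (x, y) \<Rightarrow> f x \<otimes> g y) \<noteq> \<zero>} \<subseteq> {x. f x \<noteq> \<zero>} \<times> {x. g x \<noteq> \<zero>}"
    using assms by (auto simp: fin_supp_def)
  then show ?thesis using assms unfolding fin_supp_def by (auto intro: finite_subset)
qed

lemma fin_supp_single: "fin_supp R (single R x)"
proof -
  have "{y. single R x y \<noteq> \<zero>} \<subseteq> {x}" by (auto simp: single_def)
  then show ?thesis unfolding fin_supp_def by (auto simp: single_def intro: finite_subset)
qed

text \<open>Trades the index set of the definition, which varies with \<open>f\<close> and
  \<open>y\<close>, for any finite set containing the support. Sums for different functions can then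
  be combined over a common index set, even where \<open>f x \<oplus> g x\<close> cancels.\<close>

lemma push_forward_eq:
  assumes "fin_supp R f" "finite X" "{x. f x \<noteq> \<zero>} \<subseteq> X"
  shows "push_forward R \<phi> f y = (\<Oplus>x\<in>X. if \<phi> x = y then f x else \<zero>)"
  unfolding push_forward_def
  by (rule add.finprod_mono_neutral_cong_left) (use assms in \<open>auto simp: fin_supp_def\<close>)

lemma push_forward_closed:
  assumes "fin_supp R f"
  shows "push_forward R \<phi> f y \<in> carrier R"
  unfolding push_forward_def using assms by (intro finsum_closed) (auto simp: fin_supp_def)

lemma push_forward_nonzero:
  assumes "push_forward R \<phi> f y \<noteq> \<zero>"
  obtains x where "f x \<noteq> \<zero>" "\<phi> x = y"
proof -
  have "{x. f x \<noteq> \<zero> \<and> \<phi> x = y} \<noteq> {}"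
    using assms unfolding push_forward_def by force
  then show ?thesis using that by blast
qed

lemma fin_supp_push_forward:
  assumes "fin_supp R f"
  shows "fin_supp R (push_forward R \<phi> f)"
proof -
  have "{y. push_forward R \<phi> f y \<noteq> \<zero>} \<subseteq> \<phi> ` {x. f x \<noteq> \<zero>}"
    using push_forward_nonzero[of \<phi> f] by blast
  then show ?thesis
    using assms push_forward_closed[OF assms] unfolding fin_supp_def by (auto intro: finite_subset)
qed

lemma push_forward_add:
  assumes "fin_supp R f" "fin_supp R g"
  shows "push_forward R \<phi> (\<lambda>x. f x \<oplus> g x) = (\<lambda>y. push_forward R \<phi> f y \<oplus> push_forward R \<phi> g y)"
proof
  fix y
  let ?X = "{x. f x \<noteq> \<zero>} \<union> {x. g x \<noteq> \<zero>}"
  have fin: "finite ?X" using assms by (simp add: fin_supp_def)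
  note closed = assms[THEN fin_supp_closed]
  have "push_forward R \<phi> (\<lambda>x. f x \<oplus> g x) y = (\<Oplus>x\<in>?X. if \<phi> x = y then f x \<oplus> g x else \<zero>)"
    by (rule push_forward_eq[OF fin_supp_add[OF assms] fin]) auto
  also have "\<dots> = (\<Oplus>x\<in>?X. (if \<phi> x = y then f x else \<zero>) \<oplus> (if \<phi> x = y then g x else \<zero>))"
    by (rule finsum_cong') (auto simp: closed)
  also have "\<dots> = (\<Oplus>x\<in>?X. if \<phi> x = y then f x else \<zero>) \<oplus> (\<Oplus>x\<in>?X. if \<phi> x = y then g x else \<zero>)"
    by (rule finsum_addf) (auto simp: closed)
  also have "\<dots> = push_forward R \<phi> f y \<oplus> push_forward R \<phi> g y"
    using fin by (simp add: push_forward_eq[OF assms(1), of ?X] push_forward_eq[OF assms(2), of ?X])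
  finally show "push_forward R \<phi> (\<lambda>x. f x \<oplus> g x) y = push_forward R \<phi> f y \<oplus> push_forward R \<phi> g y" .
qed

lemma push_forward_smult:
  assumes c: "c \<in> carrier R" and f: "fin_supp R f"
  shows "push_forward R \<phi> (\<lambda>x. c \<otimes> f x) = (\<lambda>y. c \<otimes> push_forward R \<phi> f y)"
proof
  fix y
  let ?X = "{x. f x \<noteq> \<zero>}"
  have fin: "finite ?X" using f by (simp add: fin_supp_def)
  note closed = fin_supp_closed[OF f]
  have "push_forward R \<phi> (\<lambda>x. c \<otimes> f x) y = (\<Oplus>x\<in>?X. if \<phi> x = y then c \<otimes> f x else \<zero>)"
    using c by (intro push_forward_eq[OF fin_supp_smult[OF c f] fin]) auto
  also have "\<dots> = (\<Oplus>x\<in>?X. c \<otimes> (if \<phi> x = y then f x else \<zero>))"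
    by (rule finsum_cong') (auto simp: closed c)
  also have "\<dots> = c \<otimes> (\<Oplus>x\<in>?X. if \<phi> x = y then f x else \<zero>)"
    by (rule finsum_rdistr[symmetric]) (auto simp: closed c fin)
  also have "\<dots> = c \<otimes> push_forward R \<phi> f y"
    using fin by (simp add: push_forward_eq[OF f, of ?X])
  finally show "push_forward R \<phi> (\<lambda>x. c \<otimes> f x) y = c \<otimes> push_forward R \<phi> f y" .
qed

lemma push_forward_single: "push_forward R \<phi> (single R x) = single R (\<phi> x)"
proof
  fix y
  have "push_forward R \<phi> (single R x) y = (\<Oplus>z\<in>{x}. if \<phi> z = y then single R x z else \<zero>)"
    by (rule push_forward_eq[OF fin_supp_single]) (auto simp: single_def)
  then show "push_forward R \<phi> (single R x) y = single R (\<phi> x) y"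
    by (auto simp: single_def)
qed

lemma push_forward_cong:
  assumes "\<And>x. f x \<noteq> \<zero> \<Longrightarrow> \<phi> x = \<psi> x"
  shows "push_forward R \<phi> f = push_forward R \<psi> f"
proof
  fix y
  have "{x. f x \<noteq> \<zero> \<and> \<phi> x = y} = {x. f x \<noteq> \<zero> \<and> \<psi> x = y}" using assms by auto
  then show "push_forward R \<phi> f y = push_forward R \<psi> f y" by (simp add: push_forward_def)
qed

end

section \<open>Tuples under the slotwise product and their monoid algebra\<close>

definition tuple_mult :: "('a, 'm) ring_scheme \<Rightarrow> nat \<Rightarrow> (nat \<Rightarrow> 'a) \<Rightarrow> (nat \<Rightarrow> 'a) \<Rightarrow> nat \<Rightarrow> 'a" where
  "tuple_mult A n x y = (\<lambda>i\<in>{1..n}. x i \<otimes>\<^bsub>A\<^esub> y i)"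

definition tuple_one :: "('a, 'm) ring_scheme \<Rightarrow> nat \<Rightarrow> nat \<Rightarrow> 'a" where
  "tuple_one A n = (\<lambda>i\<in>{1..n}. \<one>\<^bsub>A\<^esub>)"

lemma tuples_eqI:
  "x \<in> tuples A n \<Longrightarrow> y \<in> tuples A n \<Longrightarrow> (\<And>i. i \<in> {1..n} \<Longrightarrow> x i = y i) \<Longrightarrow> x = y"
  unfolding tuples_def by (rule PiE_ext)

lemma tuples_upd: "x \<in> tuples A n \<Longrightarrow> i \<in> {1..n} \<Longrightarrow> a \<in> carrier A \<Longrightarrow> x(i := a) \<in> tuples A n"
  by (auto simp: tuples_def PiE_iff extensional_def)

lemma tuples_closed: "x \<in> tuples A n \<Longrightarrow> i \<in> {1..n} \<Longrightarrow> x i \<in> carrier A"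
  by (auto simp: tuples_def)

context assoc_algebra
begin

abbreviation FT :: "nat \<Rightarrow> ('a, (nat \<Rightarrow> 'c) \<Rightarrow> 'a) module" where
  "FT n \<equiv> free_tensor R M n"

lemma tuple_mult_closed:
  "x \<in> tuples M n \<Longrightarrow> y \<in> tuples M n \<Longrightarrow> tuple_mult M n x y \<in> tuples M n"
  by (auto simp: tuples_def tuple_mult_def)

lemma tuple_one_closed: "tuple_one M n \<in> tuples M n"
  by (auto simp: tuples_def tuple_one_def)

lemma tuple_mult_at: "i \<in> {1..n} \<Longrightarrow> tuple_mult M n x y i = x i \<otimes>\<^bsub>M\<^esub> y i"
  by (simp add: tuple_mult_def)

lemma tuple_one_at: "i \<in> {1..n} \<Longrightarrow> tuple_one M n i = \<one>\<^bsub>M\<^esub>"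
  by (simp add: tuple_one_def)

lemma FT_carrier: "f \<in> carrier (FT n) \<longleftrightarrow> fin_supp R f \<and> (\<forall>x. f x \<noteq> \<zero> \<longrightarrow> x \<in> tuples M n)"
  by (auto simp: free_tensor_def fin_supp_def)

lemma FT_fin_supp: "f \<in> carrier (FT n) \<Longrightarrow> fin_supp R f"
  by (simp add: FT_carrier)

lemma FT_add: "f \<oplus>\<^bsub>FT n\<^esub> g = (\<lambda>x. f x \<oplus> g x)"
  by (simp add: free_tensor_def)

lemma FT_zero: "\<zero>\<^bsub>FT n\<^esub> = (\<lambda>x. \<zero>)"
  by (simp add: free_tensor_def)

lemma FT_smult: "c \<odot>\<^bsub>FT n\<^esub> f = (\<lambda>x. c \<otimes> f x)"
  by (simp add: free_tensor_def)

lemma FT_one: "\<one>\<^bsub>FT n\<^esub> = single R (tuple_one M n)"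
  by (simp add: free_tensor_def tuple_one_def)

text \<open>In this form bilinearity of the product becomes linearity of
  \<open>push_forward\<close>. The two sums have different index sets: the base ring may have zero
  divisors, so \<open>f x \<otimes> g y\<close> can vanish although neither factor does. The surplus
  terms are zero.\<close>

lemma FT_mult:
  assumes "f \<in> carrier (FT n)" "g \<in> carrier (FT n)"
  shows "f \<otimes>\<^bsub>FT n\<^esub> g =
    push_forward R (\<lambda>(x, y). tuple_mult M n x y) (\<lambda>(x, y). f x \<otimes> g y)"
proof
  fix z
  let ?S = "{(x, y). f x \<noteq> \<zero> \<and> g y \<noteq> \<zero> \<and> tuple_mult M n x y = z}"
  have fs: "fin_supp R f" "fin_supp R g" using assms by (simp_all add: FT_carrier)
  have "finite ({x. f x \<noteq> \<zero>} \<times> {y. g y \<noteq> \<zero>})" using fs by (simp add: fin_supp_def)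
  then have "finite ?S" by (rule rev_finite_subset) auto
  then have "(\<Oplus>p\<in>?S. f (fst p) \<otimes> g (snd p)) =
      (\<Oplus>p\<in>{p. (case p of (x, y) \<Rightarrow> f x \<otimes> g y) \<noteq> \<zero> \<and> (case p of (x, y) \<Rightarrow> tuple_mult M n x y) = z}.
        case p of (x, y) \<Rightarrow> f x \<otimes> g y)"
    by (rule R.add.finprod_mono_neutral_cong_right) (use fs in \<open>auto simp: fin_supp_closed\<close>)
  then show "(f \<otimes>\<^bsub>FT n\<^esub> g) z =
      push_forward R (\<lambda>(x, y). tuple_mult M n x y) (\<lambda>(x, y). f x \<otimes> g y) z"
    by (simp add: free_tensor_def push_forward_def tuple_mult_def)
qed

lemma FT_single_closed: "x \<in> tuples M n \<Longrightarrow> single R x \<in> carrier (FT n)"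
  by (auto simp: FT_carrier fin_supp_single) (simp add: single_def split: if_splits)

lemma FT_module: "module R (FT n)"
proof (rule moduleI)
  show "abelian_group (FT n)"
  proof (rule abelian_groupI)
    fix f assume f: "f \<in> carrier (FT n)"
    \<comment> \<open>The additive inverse is written as a scalar multiple so that
      \<open>fin_supp_smult\<close> bounds its support.\<close>
    have "(\<lambda>x. (\<ominus> \<one>) \<otimes> f x) \<in> carrier (FT n)"
      using f by (auto simp: FT_carrier intro: fin_supp_smult) (metis R.r_null R.add.inv_closed R.one_closed)
    moreover have "(\<lambda>x. (\<ominus> \<one>) \<otimes> f x) \<oplus>\<^bsub>FT n\<^esub> f = \<zero>\<^bsub>FT n\<^esub>"
      using fin_supp_closed[OF FT_fin_supp[OF f]] by (simp add: FT_add FT_zero R.l_minus R.l_neg)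
    ultimately show "\<exists>g\<in>carrier (FT n). g \<oplus>\<^bsub>FT n\<^esub> f = \<zero>\<^bsub>FT n\<^esub>" by blast
  next
    fix f g assume fg: "f \<in> carrier (FT n)" "g \<in> carrier (FT n)"
    have "x \<in> tuples M n" if "f x \<oplus> g x \<noteq> \<zero>" for x
    proof -
      have "f x \<noteq> \<zero> \<or> g x \<noteq> \<zero>" using that by auto
      then show ?thesis using fg by (auto simp: FT_carrier)
    qed
    then show "f \<oplus>\<^bsub>FT n\<^esub> g \<in> carrier (FT n)"
      using fg by (auto simp: FT_carrier FT_add fin_supp_add)
  qed (auto simp: FT_carrier FT_add FT_zero fin_supp_closed R.a_ac fin_supp_def)
next
  fix c f assume cf: "c \<in> carrier R" "f \<in> carrier (FT n)"
  have "x \<in> tuples M n" if "c \<otimes> f x \<noteq> \<zero>" for x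
  proof -
    have "f x \<noteq> \<zero>" using that cf by auto
    then show ?thesis using cf by (auto simp: FT_carrier)
  qed
  then show "c \<odot>\<^bsub>FT n\<^esub> f \<in> carrier (FT n)"
    using cf by (auto simp: FT_carrier FT_smult fin_supp_smult)
qed (auto simp: FT_carrier FT_add FT_smult fin_supp_closed R.l_distr R.r_distr R.m_assoc
    intro: R.is_cring)

text \<open>Pure tuples span the free module. The induction removes one point at a time from a
  finite set containing the support, splitting off the matching multiple of a pure tuple.\<close>

lemma FT_induct [consumes 1, case_names single add smult]:
  assumes f: "f \<in> carrier (FT n)"
    and single: "\<And>x. x \<in> tuples M n \<Longrightarrow> P (single R x)"
    and add: "\<And>f g. f \<in> carrier (FT n) \<Longrightarrow> g \<in> carrier (FT n) \<Longrightarrow> P f \<Longrightarrow> P g \<Longrightarrow> P (f \<oplus>\<^bsub>FT n\<^esub> g)"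
    and smult: "\<And>c f. c \<in> carrier R \<Longrightarrow> f \<in> carrier (FT n) \<Longrightarrow> P f \<Longrightarrow> P (c \<odot>\<^bsub>FT n\<^esub> f)"
  shows "P f"
proof -
  interpret FT: module R "FT n" by (rule FT_module)
  have "P f" if "finite S" "f \<in> carrier (FT n)" "{x. f x \<noteq> \<zero>} \<subseteq> S" for S f
    using that
  proof (induction S arbitrary: f)
    case empty
    \<comment> \<open>The rule has no case for zero, so zero is reached as the zero multiple of a
      pure tuple; the unit tuple is one that always exists.\<close>
    have "P (\<zero> \<odot>\<^bsub>FT n\<^esub> single R (tuple_one M n))"
      by (intro smult single FT_single_closed tuple_one_closed R.zero_closed)
    also have "\<zero> \<odot>\<^bsub>FT n\<^esub> single R (tuple_one M n) = \<zero>\<^bsub>FT n\<^esub>"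
      by (intro FT.smult_l_null FT_single_closed tuple_one_closed)
    also have "\<zero>\<^bsub>FT n\<^esub> = f" using empty by (auto simp: FT_zero)
    finally show ?case .
  next
    case (insert x S)
    show ?case
    proof (cases "f x = \<zero>")
      case True
      then have "{x. f x \<noteq> \<zero>} \<subseteq> S" using insert.prems by auto
      then show ?thesis using insert.IH insert.prems by blast
    next
      case False
      let ?g = "f(x := \<zero>)"
      have fs: "fin_supp R f" using insert.prems by (simp add: FT_carrier)
      have "finite {y. ?g y \<noteq> \<zero>}"
        using fs unfolding fin_supp_def by (auto elim!: rev_finite_subset)
      then have g: "?g \<in> carrier (FT n)"
        using insert.prems(1) by (auto simp: FT_carrier fin_supp_def)
      have "P ?g" using insert.prems(2) by (intro insert.IH g) auto
      moreover have x: "x \<in> tuples M n" using False insert.prems(1) by (auto simp: FT_carrier)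
      moreover have "f x \<in> carrier R" using fs by (rule fin_supp_closed)
      ultimately have "P (?g \<oplus>\<^bsub>FT n\<^esub> (f x \<odot>\<^bsub>FT n\<^esub> single R x))"
        using g by (intro add smult single FT.smult_closed FT_single_closed) simp_all
      also have "?g \<oplus>\<^bsub>FT n\<^esub> (f x \<odot>\<^bsub>FT n\<^esub> single R x) = f"
        using fin_supp_closed[OF fs] by (auto simp: FT_add FT_smult single_def)
      finally show ?thesis .
    qed
  qed
  then show ?thesis using f by (auto simp: FT_carrier fin_supp_def)
qed

lemma FT_mult_closed:
  assumes fg: "f \<in> carrier (FT n)" "g \<in> carrier (FT n)"
  shows "f \<otimes>\<^bsub>FT n\<^esub> g \<in> carrier (FT n)"
proof -
  have fs: "fin_supp R f" "fin_supp R g" using fg by (simp_all add: FT_carrier)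
  have "z \<in> tuples M n" if nz: "push_forward R (\<lambda>(x, y). tuple_mult M n x y) (\<lambda>(x, y). f x \<otimes> g y) z \<noteq> \<zero>" for z
  proof -
    obtain p where p: "(case p of (x, y) \<Rightarrow> f x \<otimes> g y) \<noteq> \<zero>" "(case p of (x, y) \<Rightarrow> tuple_mult M n x y) = z"
      using push_forward_nonzero[OF nz] by metis
    obtain x y where xy: "p = (x, y)" by (cases p)
    then have "f x \<noteq> \<zero>" "g y \<noteq> \<zero>" using p(1) fs by (auto simp: fin_supp_closed)
    then show ?thesis using p(2) xy fg by (auto simp: FT_carrier intro: tuple_mult_closed)
  qed
  then show ?thesis
    using fs fg by (auto simp: FT_carrier FT_mult fin_supp_push_forward fin_supp_times)
qed

lemma FT_l_distr:
  assumes "f \<in> carrier (FT n)" "g \<in> carrier (FT n)" "h \<in> carrier (FT n)"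
  shows "(f \<oplus>\<^bsub>FT n\<^esub> g) \<otimes>\<^bsub>FT n\<^esub> h = f \<otimes>\<^bsub>FT n\<^esub> h \<oplus>\<^bsub>FT n\<^esub> g \<otimes>\<^bsub>FT n\<^esub> h"
proof -
  interpret FT: module R "FT n" by (rule FT_module)
  note fs = assms[THEN FT_fin_supp]
  have "(\<lambda>(x, y). (f x \<oplus> g x) \<otimes> h y) =
      (\<lambda>p. (case p of (x, y) \<Rightarrow> f x \<otimes> h y) \<oplus> (case p of (x, y) \<Rightarrow> g x \<otimes> h y))"
    using fs by (auto simp: fin_supp_closed R.l_distr)
  then show ?thesis
    using assms fs FT.a_closed[OF assms(1,2)]
    by (simp add: FT_mult push_forward_add fin_supp_times) (simp add: FT_add push_forward_add fin_supp_times)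
qed

lemma FT_r_distr:
  assumes "f \<in> carrier (FT n)" "g \<in> carrier (FT n)" "h \<in> carrier (FT n)"
  shows "h \<otimes>\<^bsub>FT n\<^esub> (f \<oplus>\<^bsub>FT n\<^esub> g) = h \<otimes>\<^bsub>FT n\<^esub> f \<oplus>\<^bsub>FT n\<^esub> h \<otimes>\<^bsub>FT n\<^esub> g"
proof -
  interpret FT: module R "FT n" by (rule FT_module)
  note fs = assms[THEN FT_fin_supp]
  have "(\<lambda>(x, y). h x \<otimes> (f y \<oplus> g y)) =
      (\<lambda>p. (case p of (x, y) \<Rightarrow> h x \<otimes> f y) \<oplus> (case p of (x, y) \<Rightarrow> h x \<otimes> g y))"
    using fs by (auto simp: fin_supp_closed R.r_distr)
  then show ?thesis
    using assms fs FT.a_closed[OF assms(1,2)]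
    by (simp add: FT_mult push_forward_add fin_supp_times) (simp add: FT_add push_forward_add fin_supp_times)
qed

lemma FT_smult_mult_left:
  assumes "c \<in> carrier R" "f \<in> carrier (FT n)" "g \<in> carrier (FT n)"
  shows "(c \<odot>\<^bsub>FT n\<^esub> f) \<otimes>\<^bsub>FT n\<^esub> g = c \<odot>\<^bsub>FT n\<^esub> (f \<otimes>\<^bsub>FT n\<^esub> g)"
proof -
  interpret FT: module R "FT n" by (rule FT_module)
  note fs = assms(2,3)[THEN FT_fin_supp]
  have "(\<lambda>(x, y). (c \<otimes> f x) \<otimes> g y) = (\<lambda>p. c \<otimes> (case p of (x, y) \<Rightarrow> f x \<otimes> g y))"
    using fs assms(1) by (auto simp: fin_supp_closed R.m_assoc)
  then show ?thesis
    using assms fs FT.smult_closed[OF assms(1,2)]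
    by (simp add: FT_mult) (simp add: FT_smult push_forward_smult fin_supp_times)
qed

lemma FT_smult_mult_right:
  assumes "c \<in> carrier R" "f \<in> carrier (FT n)" "g \<in> carrier (FT n)"
  shows "f \<otimes>\<^bsub>FT n\<^esub> (c \<odot>\<^bsub>FT n\<^esub> g) = c \<odot>\<^bsub>FT n\<^esub> (f \<otimes>\<^bsub>FT n\<^esub> g)"
proof -
  interpret FT: module R "FT n" by (rule FT_module)
  note fs = assms(2,3)[THEN FT_fin_supp]
  have "(\<lambda>(x, y). f x \<otimes> (c \<otimes> g y)) = (\<lambda>p. c \<otimes> (case p of (x, y) \<Rightarrow> f x \<otimes> g y))"
    using fs assms(1) by (auto simp: fin_supp_closed R.m_lcomm)
  then show ?thesis
    using assms fs FT.smult_closed[OF assms(1,3)]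
    by (simp add: FT_mult) (simp add: FT_smult push_forward_smult fin_supp_times)
qed

lemma FT_single_mult:
  assumes "x \<in> tuples M n" "y \<in> tuples M n"
  shows "single R x \<otimes>\<^bsub>FT n\<^esub> single R y = single R (tuple_mult M n x y)"
proof -
  have "(\<lambda>(x', y'). single R x x' \<otimes> single R y y') = single R (x, y)"
    by (auto simp: single_def)
  then show ?thesis using assms by (simp add: FT_mult FT_single_closed push_forward_single)
qed

lemma tuple_mult_assoc:
  assumes "x \<in> tuples M n" "y \<in> tuples M n" "z \<in> tuples M n"
  shows "tuple_mult M n (tuple_mult M n x y) z = tuple_mult M n x (tuple_mult M n y z)"
  by (rule tuples_eqI)
    (use assms in \<open>auto intro: tuple_mult_closed simp: tuple_mult_at tuples_closed m_assoc\<close>)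

text \<open>Both sides are linear in each of the three arguments, so three nested inductions leave
  pure tuples, where associativity holds slot by slot.\<close>

lemma FT_assoc:
  assumes f: "f \<in> carrier (FT n)" and g: "g \<in> carrier (FT n)" and h: "h \<in> carrier (FT n)"
  shows "(f \<otimes>\<^bsub>FT n\<^esub> g) \<otimes>\<^bsub>FT n\<^esub> h = f \<otimes>\<^bsub>FT n\<^esub> (g \<otimes>\<^bsub>FT n\<^esub> h)"
proof -
  interpret FT: module R "FT n" by (rule FT_module)
  note bilinear = FT_l_distr FT_r_distr FT_smult_mult_left FT_smult_mult_right FT_mult_closed
    FT_single_closed FT_single_mult
  show ?thesis
    using f
  proof (induction rule: FT_induct)
    case x: (single x)
    show ?case
      using g
    proof (induction rule: FT_induct)
      case y: (single y)
      show ?case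
        using h
        by (induction rule: FT_induct)
          (simp_all add: x y bilinear tuple_mult_assoc tuple_mult_closed)
    qed (simp_all add: x h bilinear)
  qed (simp_all add: g h bilinear)
qed

lemma FT_assoc_algebra: "assoc_algebra R (FT n)"
proof -
  interpret FT: module R "FT n" by (rule FT_module)
  have "ring (FT n)"
  proof (rule ringI)
    have unit: "\<one>\<^bsub>FT n\<^esub> \<otimes>\<^bsub>FT n\<^esub> f = f" "f \<otimes>\<^bsub>FT n\<^esub> \<one>\<^bsub>FT n\<^esub> = f"
      if "f \<in> carrier (FT n)" for f
    proof -
      have "tuple_mult M n (tuple_one M n) x = x" "tuple_mult M n x (tuple_one M n) = x"
        if "x \<in> tuples M n" for x
        by (rule tuples_eqI, use that in \<open>auto intro: tuple_mult_closed tuple_one_closed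
          simp: tuple_mult_at tuple_one_at tuples_closed\<close>)+
      note unit_tuple = this
      show "\<one>\<^bsub>FT n\<^esub> \<otimes>\<^bsub>FT n\<^esub> f = f"
        using that by (induction rule: FT_induct)
          (simp_all add: FT_one unit_tuple FT_single_mult tuple_one_closed FT_r_distr
            FT_single_closed FT_smult_mult_right)
      show "f \<otimes>\<^bsub>FT n\<^esub> \<one>\<^bsub>FT n\<^esub> = f"
        using that by (induction rule: FT_induct)
          (simp_all add: FT_one unit_tuple FT_single_mult tuple_one_closed FT_l_distr
            FT_single_closed FT_smult_mult_left)
    qed
    then show "monoid (FT n)"
      by (intro monoidI) (auto simp: FT_mult_closed FT_assoc FT_one FT_single_closed tuple_one_closed)
  qed (auto simp: FT_l_distr FT_r_distr FT.abelian_group_axioms)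
  then show ?thesis
    by (intro assoc_algebra.intro assoc_algebra_axioms.intro FT_module)
      (auto simp: FT_smult_mult_left FT_smult_mult_right)
qed

end

section \<open>Tensor powers as quotient algebras\<close>

text \<open>
  A separate locale, since interpreting \<open>assoc_algebra\<close> for the free modules inside itself would
  not terminate.
\<close>

locale algebra_tensor_powers = assoc_algebra
begin

sublocale FT: assoc_algebra R "FT n" for n
  by (rule FT_assoc_algebra)

abbreviation TI :: "nat \<Rightarrow> ((nat \<Rightarrow> 'c) \<Rightarrow> 'a) set" where
  "TI n \<equiv> tensor_ideal R M n"

section \<open>The submodule of multilinearity relations as a two-sided ideal\<close>

lemma relator_cases:
  assumes "r \<in> multilinear_relators R M n"
  obtains (add) x i a b where "x \<in> tuples M n" "i \<in> {1..n}" "a \<in> carrier M" "b \<in> carrier M"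
      "r = single R (x(i := a \<oplus>\<^bsub>M\<^esub> b)) \<ominus>\<^bsub>FT n\<^esub> (single R (x(i := a)) \<oplus>\<^bsub>FT n\<^esub> single R (x(i := b)))"
    | (smult) x i c a where "x \<in> tuples M n" "i \<in> {1..n}" "c \<in> carrier R" "a \<in> carrier M"
      "r = single R (x(i := c \<odot>\<^bsub>M\<^esub> a)) \<ominus>\<^bsub>FT n\<^esub> (c \<odot>\<^bsub>FT n\<^esub> single R (x(i := a)))"
  using assms unfolding multilinear_relators_def Let_def by blast

lemma relators_closed: "multilinear_relators R M n \<subseteq> carrier (FT n)"
proof
  fix r assume "r \<in> multilinear_relators R M n"
  then show "r \<in> carrier (FT n)"
    by (cases rule: relator_cases) (simp_all add: tuples_upd FT_single_closed)
qed

lemma relators_in_ideal: "multilinear_relators R M n \<subseteq> TI n"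
  unfolding tensor_ideal_def by blast

lemma tensor_ideal_least:
  "submodule N R (FT n) \<Longrightarrow> multilinear_relators R M n \<subseteq> N \<Longrightarrow> TI n \<subseteq> N"
  unfolding tensor_ideal_def by blast

text \<open>The free module itself is one of the submodules intersected in
  \<open>tensor_ideal\<close>.\<close>

lemma tensor_ideal_closed: "TI n \<subseteq> carrier (FT n)"
  using tensor_ideal_least[OF FT.carrier_is_submodule relators_closed] .

lemma tensor_ideal_submodule: "submodule (TI n) R (FT n)"
proof (rule FT.submoduleI)
  show "TI n \<subseteq> carrier (FT n)" by (rule tensor_ideal_closed)
qed (auto simp: tensor_ideal_def intro: FT.submoduleE submodule.smult_closed
    subgroup.one_closed[OF submodule.axioms(1), of _ _ "FT n", simplified])

text \<open>
  A linear map that sends pure tensors to pure tensors and is linear in each slot preserves the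
  relations. Left and right multiplication by a pure tensor, as well as relabelling of the slots,
  are of this form.
\<close>

lemma tensor_ideal_image:
  assumes h_closed: "\<And>f. f \<in> carrier (FT m) \<Longrightarrow> h f \<in> carrier (FT n)"
    and h_add: "\<And>f g. f \<in> carrier (FT m) \<Longrightarrow> g \<in> carrier (FT m) \<Longrightarrow>
      h (f \<oplus>\<^bsub>FT m\<^esub> g) = h f \<oplus>\<^bsub>FT n\<^esub> h g"
    and h_smult: "\<And>c f. c \<in> carrier R \<Longrightarrow> f \<in> carrier (FT m) \<Longrightarrow> h (c \<odot>\<^bsub>FT m\<^esub> f) = c \<odot>\<^bsub>FT n\<^esub> h f"
    and h_single: "\<And>x. x \<in> tuples M m \<Longrightarrow> h (single R x) = single R (\<phi> x)"
    and \<phi>_closed: "\<And>x. x \<in> tuples M m \<Longrightarrow> \<phi> x \<in> tuples M n"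
    and \<phi>_upd: "\<And>i x a. i \<in> {1..m} \<Longrightarrow> x \<in> tuples M m \<Longrightarrow> a \<in> carrier M \<Longrightarrow>
      \<phi> (x(i := a)) = (\<phi> x)(s i := g i x a)"
    and s: "\<And>i. i \<in> {1..m} \<Longrightarrow> s i \<in> {1..n}"
    and g_closed: "\<And>i x a. i \<in> {1..m} \<Longrightarrow> x \<in> tuples M m \<Longrightarrow> a \<in> carrier M \<Longrightarrow> g i x a \<in> carrier M"
    and g_add: "\<And>i x a b. i \<in> {1..m} \<Longrightarrow> x \<in> tuples M m \<Longrightarrow> a \<in> carrier M \<Longrightarrow> b \<in> carrier M \<Longrightarrow>
      g i x (a \<oplus>\<^bsub>M\<^esub> b) = g i x a \<oplus>\<^bsub>M\<^esub> g i x b"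
    and g_smult: "\<And>i x c a. i \<in> {1..m} \<Longrightarrow> x \<in> tuples M m \<Longrightarrow> c \<in> carrier R \<Longrightarrow> a \<in> carrier M \<Longrightarrow>
      g i x (c \<odot>\<^bsub>M\<^esub> a) = c \<odot>\<^bsub>M\<^esub> g i x a"
    and r: "r \<in> TI m"
  shows "h r \<in> TI n"
proof -
  have h_zero: "h \<zero>\<^bsub>FT m\<^esub> = \<zero>\<^bsub>FT n\<^esub>"
    using h_smult[of \<zero> "\<zero>\<^bsub>FT m\<^esub>"] h_closed by simp
  have h_minus: "h (\<ominus>\<^bsub>FT m\<^esub> f) = \<ominus>\<^bsub>FT n\<^esub> h f" if "f \<in> carrier (FT m)" for f
  proof (rule FT.minus_equality[symmetric])
    show "h (\<ominus>\<^bsub>FT m\<^esub> f) \<oplus>\<^bsub>FT n\<^esub> h f = \<zero>\<^bsub>FT n\<^esub>"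
      using that h_zero by (simp add: FT.l_neg flip: h_add)
  qed (use that h_closed in auto)
  \<comment> \<open>By minimality of the ideal it suffices that the preimage of \<open>TI n\<close>
    under \<open>h\<close> is a submodule containing the relators.\<close>
  let ?N = "{f \<in> carrier (FT m). h f \<in> TI n}"
  note submod = FT.submoduleE[OF tensor_ideal_submodule]
  have "submodule ?N R (FT m)"
  proof (rule FT.submoduleI)
    show "\<zero>\<^bsub>FT m\<^esub> \<in> ?N"
      using subgroup.one_closed[OF submodule.axioms(1)[OF tensor_ideal_submodule]] h_zero by simp
  qed (auto simp: h_add h_smult h_minus intro: submod)
  moreover have "multilinear_relators R M m \<subseteq> ?N"
  proof
    fix r assume r: "r \<in> multilinear_relators R M m"
    \<comment> \<open>Changing slot \<open>i\<close> of \<open>x\<close> changes only slot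
      \<open>s i\<close> of \<open>\<phi> x\<close>, and linearly in the new entry; so a relator in
      slot \<open>i\<close> becomes a relator of the same kind in slot \<open>s i\<close>.\<close>
    have "h r \<in> multilinear_relators R M n"
      using r
    proof (cases rule: relator_cases)
      case (add x i a b)
      then have "h r = single R ((\<phi> x)(s i := g i x a \<oplus>\<^bsub>M\<^esub> g i x b)) \<ominus>\<^bsub>FT n\<^esub>
          (single R ((\<phi> x)(s i := g i x a)) \<oplus>\<^bsub>FT n\<^esub> single R ((\<phi> x)(s i := g i x b)))"
        by (simp add: a_minus_def tuples_upd FT_single_closed h_add h_minus h_single \<phi>_upd g_add)
      then show ?thesis
        using add s[of i] \<phi>_closed[of x] g_closed[of i x a] g_closed[of i x b]
        unfolding multilinear_relators_def Let_def by blast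
    next
      case (smult x i c a)
      then have "h r = single R ((\<phi> x)(s i := c \<odot>\<^bsub>M\<^esub> g i x a)) \<ominus>\<^bsub>FT n\<^esub>
          (c \<odot>\<^bsub>FT n\<^esub> single R ((\<phi> x)(s i := g i x a)))"
        by (simp add: a_minus_def tuples_upd FT_single_closed h_add h_minus h_smult h_single \<phi>_upd g_smult)
      then show ?thesis
        using smult s[of i] \<phi>_closed[of x] g_closed[of i x a]
        unfolding multilinear_relators_def Let_def by blast
    qed
    then show "r \<in> ?N" using r relators_closed relators_in_ideal by blast
  qed
  ultimately show ?thesis using tensor_ideal_least r by blast
qed

lemma tensor_ideal_mult_single:
  assumes y: "y \<in> tuples M n" and r: "r \<in> TI n"
  shows "single R y \<otimes>\<^bsub>FT n\<^esub> r \<in> TI n" "r \<otimes>\<^bsub>FT n\<^esub> single R y \<in> TI n"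
proof -
  show "single R y \<otimes>\<^bsub>FT n\<^esub> r \<in> TI n"
  proof (rule tensor_ideal_image[where h = "\<lambda>f. single R y \<otimes>\<^bsub>FT n\<^esub> f" and m = n
        and \<phi> = "tuple_mult M n y" and s = "\<lambda>i. i" and g = "\<lambda>i x a. y i \<otimes>\<^bsub>M\<^esub> a"])
    show "tuple_mult M n y (x(i := a)) = (tuple_mult M n y x)(i := y i \<otimes>\<^bsub>M\<^esub> a)" if "i \<in> {1..n}" for x i a
      using that by (auto simp: tuple_mult_def)
  qed (use y r in \<open>auto simp: FT_single_closed FT.r_distr FT.smult_mult_right FT_single_mult
      tuple_mult_closed tuples_closed r_distr smult_mult_right\<close>)
  show "r \<otimes>\<^bsub>FT n\<^esub> single R y \<in> TI n"
  proof (rule tensor_ideal_image[where h = "\<lambda>f. f \<otimes>\<^bsub>FT n\<^esub> single R y" and m = n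
        and \<phi> = "\<lambda>x. tuple_mult M n x y" and s = "\<lambda>i. i" and g = "\<lambda>i x a. a \<otimes>\<^bsub>M\<^esub> y i"])
    show "tuple_mult M n (x(i := a)) y = (tuple_mult M n x y)(i := a \<otimes>\<^bsub>M\<^esub> y i)" if "i \<in> {1..n}" for x i a
      using that by (auto simp: tuple_mult_def)
  qed (use y r in \<open>auto simp: FT_single_closed FT.l_distr FT.smult_mult_left FT_single_mult
      tuple_mult_closed tuples_closed l_distr smult_mult_left\<close>)
qed

text \<open>With \<open>r\<close> fixed, both products are linear in \<open>f\<close>, and the ideal
  is a submodule; this reduces the claim to a pure tuple \<open>f\<close>, which is
  \<open>tensor_ideal_mult_single\<close>.\<close>

lemma tensor_ideal_ideal: "ideal (TI n) (FT n)"
proof (rule idealI)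
  show "subgroup (TI n) (add_monoid (FT n))"
    by (rule submodule.axioms(1)[OF tensor_ideal_submodule])
  fix r f assume r: "r \<in> TI n" and f: "f \<in> carrier (FT n)"
  note rc = subsetD[OF tensor_ideal_closed r] and submod = FT.submoduleE[OF tensor_ideal_submodule]
  show "f \<otimes>\<^bsub>FT n\<^esub> r \<in> TI n"
    using f by (induction rule: FT_induct)
      (auto simp: tensor_ideal_mult_single r rc FT.l_distr FT.smult_mult_left intro: submod)
  show "r \<otimes>\<^bsub>FT n\<^esub> f \<in> TI n"
    using f by (induction rule: FT_induct)
      (auto simp: tensor_ideal_mult_single r rc FT.r_distr FT.smult_mult_right intro: submod)
qed (rule FT.ring_axioms)

sublocale TI: ideal "TI n" "FT n" for n
  by (rule tensor_ideal_ideal)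

section \<open>Residue classes and the quotient algebra\<close>

abbreviation TP :: "nat \<Rightarrow> ('a, ((nat \<Rightarrow> 'c) \<Rightarrow> 'a) set) module" where
  "TP n \<equiv> tensor_power R M n"

definition tclass :: "nat \<Rightarrow> ((nat \<Rightarrow> 'c) \<Rightarrow> 'a) \<Rightarrow> ((nat \<Rightarrow> 'c) \<Rightarrow> 'a) set" where
  "tclass n f = TI n +>\<^bsub>FT n\<^esub> f"

lemma tclass_iff: "g \<in> tclass n f \<longleftrightarrow> (\<exists>r\<in>TI n. g = r \<oplus>\<^bsub>FT n\<^esub> f)"
  by (auto simp: tclass_def a_r_coset_def')

lemma tclass_self: "f \<in> carrier (FT n) \<Longrightarrow> f \<in> tclass n f"
  unfolding tclass_def by (rule TI.a_rcos_self)

lemma tclass_shift: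
  assumes "r \<in> TI n" "f \<in> carrier (FT n)"
  shows "tclass n (r \<oplus>\<^bsub>FT n\<^esub> f) = tclass n f"
  unfolding tclass_def
  using assms FT.a_repr_independence[OF _ assms(2) TI.a_subgroup] FT.a_rcosI[OF assms(1) tensor_ideal_closed assms(2)]
  by simp

text \<open>Scalar multiplication and \<open>tensor_map\<close> are defined as unions over all
  representatives of a class. Such a union collapses once its members are invariant under adding
  elements of the ideal, because a class is never empty.\<close>

lemma tclass_UN:
  assumes f: "f \<in> carrier (FT n)"
    and const: "\<And>r. r \<in> TI n \<Longrightarrow> G (r \<oplus>\<^bsub>FT n\<^esub> f) = C"
  shows "(\<Union>g\<in>tclass n f. G g) = C"
proof -
  have "(\<Union>g\<in>tclass n f. G g) = (\<Union>g\<in>tclass n f. C)"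
    by (rule SUP_cong) (auto simp: tclass_iff const)
  then show ?thesis using tclass_self[OF f] by auto
qed

lemma TP_carrier: "carrier (TP n) = tclass n ` carrier (FT n)"
  by (auto simp: tensor_power_def Let_def FactRing_def A_RCOSETS_def' tclass_def)

lemma TP_cases:
  assumes "X \<in> carrier (TP n)"
  obtains f where "f \<in> carrier (FT n)" "X = tclass n f"
  using assms by (auto simp: TP_carrier)

lemma tclass_closed: "f \<in> carrier (FT n) \<Longrightarrow> tclass n f \<in> carrier (TP n)"
  by (simp add: TP_carrier)

lemma tclass_add:
  assumes "f \<in> carrier (FT n)" "g \<in> carrier (FT n)"
  shows "tclass n f \<oplus>\<^bsub>TP n\<^esub> tclass n g = tclass n (f \<oplus>\<^bsub>FT n\<^esub> g)"
  using assms by (simp add: tensor_power_def Let_def FactRing_def tclass_def TI.a_rcos_sum)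

lemma tclass_mult:
  assumes "f \<in> carrier (FT n)" "g \<in> carrier (FT n)"
  shows "tclass n f \<otimes>\<^bsub>TP n\<^esub> tclass n g = tclass n (f \<otimes>\<^bsub>FT n\<^esub> g)"
  using assms by (simp add: tensor_power_def Let_def FactRing_def tclass_def TI.rcoset_mult_add)

lemma TP_one: "\<one>\<^bsub>TP n\<^esub> = tclass n \<one>\<^bsub>FT n\<^esub>"
  by (simp add: tensor_power_def Let_def FactRing_def tclass_def)

lemma TP_zero: "\<zero>\<^bsub>TP n\<^esub> = tclass n \<zero>\<^bsub>FT n\<^esub>"
  by (simp add: tensor_power_def Let_def FactRing_def tclass_def FT.a_coset_add_zero tensor_ideal_closed)

lemma tclass_smult:
  assumes c: "c \<in> carrier R" and f: "f \<in> carrier (FT n)"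
  shows "c \<odot>\<^bsub>TP n\<^esub> tclass n f = tclass n (c \<odot>\<^bsub>FT n\<^esub> f)"
proof -
  have "c \<odot>\<^bsub>TP n\<^esub> tclass n f = (\<Union>g\<in>tclass n f. tclass n (c \<odot>\<^bsub>FT n\<^esub> g))"
    by (simp add: tensor_power_def Let_def tclass_def)
  also have "\<dots> = tclass n (c \<odot>\<^bsub>FT n\<^esub> f)"
  proof (rule tclass_UN[OF f])
    fix r assume r: "r \<in> TI n"
    then have "c \<odot>\<^bsub>FT n\<^esub> (r \<oplus>\<^bsub>FT n\<^esub> f) = c \<odot>\<^bsub>FT n\<^esub> r \<oplus>\<^bsub>FT n\<^esub> c \<odot>\<^bsub>FT n\<^esub> f"
      using c f tensor_ideal_closed by (intro FT.smult_r_distr) auto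
    then show "tclass n (c \<odot>\<^bsub>FT n\<^esub> (r \<oplus>\<^bsub>FT n\<^esub> f)) = tclass n (c \<odot>\<^bsub>FT n\<^esub> f)"
      using c f r submodule.smult_closed[OF tensor_ideal_submodule] by (simp add: tclass_shift)
  qed
  finally show ?thesis .
qed

lemmas TP_simps = tclass_closed tclass_add tclass_mult TP_one TP_zero tclass_smult

lemma TP_assoc_algebra: "assoc_algebra R (TP n)"
proof -
  have ab: "abelian_group (TP n)"
  proof (rule abelian_groupI)
    fix X assume "X \<in> carrier (TP n)"
    then obtain f where f: "f \<in> carrier (FT n)" "X = tclass n f" by (rule TP_cases)
    then have "tclass n (\<ominus>\<^bsub>FT n\<^esub> f) \<oplus>\<^bsub>TP n\<^esub> X = \<zero>\<^bsub>TP n\<^esub>" by (simp add: TP_simps FT.l_neg)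
    then show "\<exists>Y\<in>carrier (TP n). Y \<oplus>\<^bsub>TP n\<^esub> X = \<zero>\<^bsub>TP n\<^esub>"
      using f by (auto intro!: bexI tclass_closed)
  qed (auto elim!: TP_cases simp: TP_simps FT.a_ac)
  have mon: "monoid (TP n)"
    by (rule monoidI) (auto elim!: TP_cases simp: TP_simps FT.m_assoc)
  have ring: "ring (TP n)"
    by (rule ringI[OF ab mon]) (auto elim!: TP_cases simp: TP_simps FT.l_distr FT.r_distr)
  have mod: "module R (TP n)"
    by (rule moduleI[OF R.is_cring ab])
      (auto elim!: TP_cases simp: TP_simps FT.smult_l_distr FT.smult_r_distr FT.smult_assoc1)
  show ?thesis
    by (intro assoc_algebra.intro assoc_algebra_axioms.intro mod ring)
      (auto elim!: TP_cases simp: TP_simps FT.smult_mult_left FT.smult_mult_right)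
qed

sublocale TP: assoc_algebra R "TP n" for n
  by (rule TP_assoc_algebra)

end

section \<open>Functoriality in the slots\<close>

definition slot_inj :: "nat \<Rightarrow> nat \<Rightarrow> (nat \<Rightarrow> nat) \<Rightarrow> bool" where
  "slot_inj m n \<sigma> \<longleftrightarrow> inj_on \<sigma> {1..m} \<and> \<sigma> ` {1..m} \<subseteq> {1..n}"

lemma slot_inj_comp: "slot_inj m n \<sigma> \<Longrightarrow> slot_inj n l \<tau> \<Longrightarrow> slot_inj m l (\<tau> \<circ> \<sigma>)"
  unfolding slot_inj_def by (auto intro: comp_inj_on inj_on_subset simp: image_comp[symmetric])

lemma slot_inj_at: "slot_inj m n \<sigma> \<Longrightarrow> j \<in> {1..m} \<Longrightarrow> \<sigma> j \<in> {1..n}"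
  unfolding slot_inj_def by blast

lemma slot_inj_id: "slot_inj n n id"
  by (simp add: slot_inj_def)

text \<open>Defined on all of \<open>nat\<close> and not only on the two slots, so that
  \<open>leg_slots_comp\<close> is an equality of functions.\<close>

definition leg_slots :: "nat \<Rightarrow> nat \<Rightarrow> nat \<Rightarrow> nat" where
  "leg_slots r s = (\<lambda>j. if j = 1 then r else s)"

lemma atLeastAtMost_1_2: "{1..2::nat} = {1, 2}"
  by auto

lemma slot_inj_leg:
  "r \<in> {1..n} \<Longrightarrow> s \<in> {1..n} \<Longrightarrow> r \<noteq> s \<Longrightarrow> slot_inj 2 n (leg_slots r s)"
  unfolding slot_inj_def leg_slots_def atLeastAtMost_1_2 by (auto simp: inj_on_def)

lemma slot_inj_transpose: "i \<in> {1..<n} \<Longrightarrow> slot_inj n n (Transposition.transpose i (i + 1))"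
  by (auto simp: slot_inj_def Transposition.transpose_def inj_on_def split: if_splits)

text \<open>
  The legs \<open>\<rho>\<^sub>r\<^sub>s\<close>, the flips \<open>P\<^sub>i\<close> and the inclusion of the third into the \<open>n\<close>-th tensor power
  are all instances: the factor \<open>j\<close> moves to the slot \<open>\<sigma> j\<close>, and the other slots are filled with \<open>1\<close>.
\<close>

definition tuple_embed :: "('a, 'm) ring_scheme \<Rightarrow> nat \<Rightarrow> nat \<Rightarrow> (nat \<Rightarrow> nat) \<Rightarrow> (nat \<Rightarrow> 'a) \<Rightarrow> nat \<Rightarrow> 'a" where
  "tuple_embed A m n \<sigma> x =
     (\<lambda>i\<in>{1..n}. if i \<in> \<sigma> ` {1..m} then x (inv_into {1..m} \<sigma> i) else \<one>\<^bsub>A\<^esub>)"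

lemma tuple_embed_at:
  "slot_inj m n \<sigma> \<Longrightarrow> j \<in> {1..m} \<Longrightarrow> tuple_embed A m n \<sigma> x (\<sigma> j) = x j"
  by (simp add: tuple_embed_def slot_inj_def inv_into_f_f image_subset_iff del: atLeastAtMost_iff)

lemma tuple_embed_off:
  "i \<in> {1..n} \<Longrightarrow> i \<notin> \<sigma> ` {1..m} \<Longrightarrow> tuple_embed A m n \<sigma> x i = \<one>\<^bsub>A\<^esub>"
  by (simp add: tuple_embed_def)

definition tensor_embed ::
    "('k, 'r) ring_scheme \<Rightarrow> ('k, 'a, 'm) module_scheme \<Rightarrow> nat \<Rightarrow> nat \<Rightarrow> (nat \<Rightarrow> nat) \<Rightarrow>
     ((nat \<Rightarrow> 'a) \<Rightarrow> 'k) set \<Rightarrow> ((nat \<Rightarrow> 'a) \<Rightarrow> 'k) set" where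
  "tensor_embed k A m n \<sigma> = tensor_map k A m n (tuple_embed A m n \<sigma>)"

context algebra_tensor_powers
begin

lemma tuple_embed_closed:
  assumes "slot_inj m n \<sigma>" "x \<in> tuples M m"
  shows "tuple_embed M m n \<sigma> x \<in> tuples M n"
proof -
  have "tuple_embed M m n \<sigma> x i \<in> carrier M" if i: "i \<in> {1..n}" for i
  proof (cases "i \<in> \<sigma> ` {1..m}")
    case True
    then obtain j where "j \<in> {1..m}" "i = \<sigma> j" by blast
    then show ?thesis using tuples_closed[OF assms(2)] by (simp add: tuple_embed_at[OF assms(1)])
  qed (use i in \<open>simp add: tuple_embed_off del: atLeastAtMost_iff\<close>)
  then show ?thesis by (auto simp: tuples_def tuple_embed_def)
qed

text \<open>Isolates the two properties that determine an embedded tuple, so that the laws below are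
  proved without handling \<open>inv_into\<close>.\<close>

lemma tuple_embed_eqI:
  assumes \<sigma>: "slot_inj m n \<sigma>" and x: "x \<in> tuples M m" and y: "y \<in> tuples M n"
    and at: "\<And>j. j \<in> {1..m} \<Longrightarrow> y (\<sigma> j) = x j"
    and off: "\<And>i. i \<in> {1..n} \<Longrightarrow> i \<notin> \<sigma> ` {1..m} \<Longrightarrow> y i = \<one>\<^bsub>M\<^esub>"
  shows "tuple_embed M m n \<sigma> x = y"
proof (rule tuples_eqI[OF tuple_embed_closed[OF \<sigma> x] y])
  fix i assume i: "i \<in> {1..n}"
  show "tuple_embed M m n \<sigma> x i = y i"
  proof (cases "i \<in> \<sigma> ` {1..m}")
    case True
    then obtain j where "j \<in> {1..m}" "i = \<sigma> j" by blast
    then show ?thesis using at by (simp add: tuple_embed_at[OF \<sigma>])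
  next
    case False
    then show ?thesis using tuple_embed_off[OF i False] off[OF i False] by simp
  qed
qed

lemma tuple_embed_mult:
  assumes \<sigma>: "slot_inj m n \<sigma>" and x: "x \<in> tuples M m" and y: "y \<in> tuples M m"
  shows "tuple_embed M m n \<sigma> (tuple_mult M m x y) =
    tuple_mult M n (tuple_embed M m n \<sigma> x) (tuple_embed M m n \<sigma> y)"
proof (rule tuple_embed_eqI[OF \<sigma>])
  fix j assume j: "j \<in> {1..m}"
  then have "\<sigma> j \<in> {1..n}" by (rule slot_inj_at[OF \<sigma>])
  then show "tuple_mult M n (tuple_embed M m n \<sigma> x) (tuple_embed M m n \<sigma> y) (\<sigma> j) = tuple_mult M m x y j"
    using j by (simp add: tuple_mult_at tuple_embed_at[OF \<sigma>] del: atLeastAtMost_iff)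
qed (simp_all add: x y \<sigma> tuple_mult_closed tuple_embed_closed tuple_mult_at tuple_embed_off
    del: atLeastAtMost_iff)

lemma tuple_embed_one:
  assumes \<sigma>: "slot_inj m n \<sigma>"
  shows "tuple_embed M m n \<sigma> (tuple_one M m) = tuple_one M n"
proof (rule tuple_embed_eqI[OF \<sigma>])
  fix j assume j: "j \<in> {1..m}"
  then have "\<sigma> j \<in> {1..n}" by (rule slot_inj_at[OF \<sigma>])
  then show "tuple_one M n (\<sigma> j) = tuple_one M m j"
    using j by (simp add: tuple_one_at del: atLeastAtMost_iff)
qed (simp_all add: tuple_one_closed tuple_one_at del: atLeastAtMost_iff)

text \<open>By injectivity of \<open>\<sigma>\<close> no slot other than \<open>\<sigma> i\<close>
  is touched. This is the slot condition of \<open>tensor_ideal_image\<close>, with the entry passed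
  on unchanged.\<close>

lemma tuple_embed_upd:
  assumes \<sigma>: "slot_inj m n \<sigma>" and x: "x \<in> tuples M m" and i: "i \<in> {1..m}" and a: "a \<in> carrier M"
  shows "tuple_embed M m n \<sigma> (x(i := a)) = (tuple_embed M m n \<sigma> x)(\<sigma> i := a)"
proof (rule tuple_embed_eqI[OF \<sigma>])
  have "\<sigma> i \<in> {1..n}" using i by (rule slot_inj_at[OF \<sigma>])
  then show "(tuple_embed M m n \<sigma> x)(\<sigma> i := a) \<in> tuples M n"
    by (rule tuples_upd[OF tuple_embed_closed[OF \<sigma> x] _ a])
  fix j assume j: "j \<in> {1..m}"
  then have "\<sigma> j = \<sigma> i \<longleftrightarrow> j = i" using \<sigma> i unfolding slot_inj_def by (blast dest: inj_onD)
  then show "((tuple_embed M m n \<sigma> x)(\<sigma> i := a)) (\<sigma> j) = (x(i := a)) j"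
    using j by (simp add: tuple_embed_at[OF \<sigma>] del: atLeastAtMost_iff)
next
  fix l assume "l \<in> {1..n}" "l \<notin> \<sigma> ` {1..m}"
  moreover from this have "l \<noteq> \<sigma> i" using i by auto
  ultimately show "((tuple_embed M m n \<sigma> x)(\<sigma> i := a)) l = \<one>\<^bsub>M\<^esub>"
    by (simp add: tuple_embed_off del: atLeastAtMost_iff)
qed (intro tuples_upd x i a)

lemma tuple_embed_comp:
  assumes \<sigma>: "slot_inj m n \<sigma>" and \<tau>: "slot_inj n l \<tau>" and x: "x \<in> tuples M m"
  shows "tuple_embed M m l (\<tau> \<circ> \<sigma>) x = tuple_embed M n l \<tau> (tuple_embed M m n \<sigma> x)"
proof (rule tuple_embed_eqI[OF slot_inj_comp[OF \<sigma> \<tau>] x])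
  show "tuple_embed M n l \<tau> (tuple_embed M m n \<sigma> x) \<in> tuples M l"
    by (rule tuple_embed_closed[OF \<tau> tuple_embed_closed[OF \<sigma> x]])
  fix j assume j: "j \<in> {1..m}"
  then have "\<sigma> j \<in> {1..n}" by (rule slot_inj_at[OF \<sigma>])
  then show "tuple_embed M n l \<tau> (tuple_embed M m n \<sigma> x) ((\<tau> \<circ> \<sigma>) j) = x j"
    using j by (simp add: tuple_embed_at[OF \<sigma>] tuple_embed_at[OF \<tau>] del: atLeastAtMost_iff)
next
  fix i assume i: "i \<in> {1..l}" "i \<notin> (\<tau> \<circ> \<sigma>) ` {1..m}"
  show "tuple_embed M n l \<tau> (tuple_embed M m n \<sigma> x) i = \<one>\<^bsub>M\<^esub>"
  \<comment> \<open>A slot missed by the composite is either missed by \<open>\<tau>\<close>, which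
    fills it with one, or receives an entry that \<open>\<sigma>\<close> had already filled with
    one.\<close>
  proof (cases "i \<in> \<tau> ` {1..n}")
    case True
    then obtain j where j: "j \<in> {1..n}" "i = \<tau> j" by blast
    then have "j \<notin> \<sigma> ` {1..m}" using i(2) by auto
    then show ?thesis
      using j by (simp add: tuple_embed_at[OF \<tau>] tuple_embed_off del: atLeastAtMost_iff)
  qed (use i in \<open>simp add: tuple_embed_off del: atLeastAtMost_iff\<close>)
qed

lemma tuple_embed_id: "x \<in> tuples M n \<Longrightarrow> tuple_embed M n n id x = x"
  by (rule tuple_embed_eqI[OF slot_inj_id]) auto

text \<open>By disjointness at least one of the two entries in each slot is one, so no commutativity
  in the algebra is required.\<close>

lemma tuple_embed_commute:
  assumes \<sigma>: "slot_inj l n \<sigma>" and \<tau>: "slot_inj m n \<tau>" and disj: "\<sigma> ` {1..l} \<inter> \<tau> ` {1..m} = {}"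
    and x: "x \<in> tuples M l" and y: "y \<in> tuples M m"
  shows "tuple_mult M n (tuple_embed M l n \<sigma> x) (tuple_embed M m n \<tau> y) =
    tuple_mult M n (tuple_embed M m n \<tau> y) (tuple_embed M l n \<sigma> x)"
proof (rule tuples_eqI[where A = M and n = n])
  let ?x = "tuple_embed M l n \<sigma> x" and ?y = "tuple_embed M m n \<tau> y"
  note closed = tuple_embed_closed[OF \<sigma> x] tuple_embed_closed[OF \<tau> y]
  fix i assume i: "i \<in> {1..n}"
  have "?x i = \<one>\<^bsub>M\<^esub> \<or> ?y i = \<one>\<^bsub>M\<^esub>"
  proof (cases "i \<in> \<sigma> ` {1..l}")
    case True
    then have "i \<notin> \<tau> ` {1..m}" using disj by blast
    then show ?thesis using tuple_embed_off[OF i, of \<tau> m M y] by blast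
  qed (use tuple_embed_off[OF i, of \<sigma> l M x] in blast)
  then show "tuple_mult M n ?x ?y i = tuple_mult M n ?y ?x i"
    using closed[THEN tuples_closed, OF i] by (auto simp: tuple_mult_at[OF i])
qed (intro tuple_mult_closed tuple_embed_closed[OF \<sigma> x] tuple_embed_closed[OF \<tau> y])+

text \<open>Addition in \<open>FT n\<close> is pointwise and the same for all \<open>n\<close>, so
  the \<open>n\<close> on the right is free and is chosen at each use.\<close>

lemma push_forward_FT_add:
  "f \<in> carrier (FT m) \<Longrightarrow> g \<in> carrier (FT m) \<Longrightarrow>
    push_forward R \<phi> (f \<oplus>\<^bsub>FT m\<^esub> g) = push_forward R \<phi> f \<oplus>\<^bsub>FT n\<^esub> push_forward R \<phi> g"
  by (simp add: FT_add push_forward_add FT_fin_supp)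

lemma push_forward_FT_smult:
  "c \<in> carrier R \<Longrightarrow> f \<in> carrier (FT m) \<Longrightarrow>
    push_forward R \<phi> (c \<odot>\<^bsub>FT m\<^esub> f) = c \<odot>\<^bsub>FT n\<^esub> push_forward R \<phi> f"
  by (simp add: FT_smult push_forward_smult FT_fin_supp)

lemma push_forward_FT_closed:
  assumes "\<And>x. x \<in> tuples M m \<Longrightarrow> \<phi> x \<in> tuples M n" "f \<in> carrier (FT m)"
  shows "push_forward R \<phi> f \<in> carrier (FT n)"
  using assms by (auto simp: FT_carrier fin_supp_push_forward elim!: push_forward_nonzero)

lemma push_forward_FT_cong:
  assumes "\<And>x. x \<in> tuples M m \<Longrightarrow> \<phi> x = \<psi> x" "f \<in> carrier (FT m)"
  shows "push_forward R \<phi> f = push_forward R \<psi> f"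
  using assms by (auto simp: FT_carrier intro!: push_forward_cong)

abbreviation push :: "nat \<Rightarrow> nat \<Rightarrow> (nat \<Rightarrow> nat) \<Rightarrow> ((nat \<Rightarrow> 'c) \<Rightarrow> 'a) \<Rightarrow> (nat \<Rightarrow> 'c) \<Rightarrow> 'a" where
  "push m n \<sigma> \<equiv> push_forward R (tuple_embed M m n \<sigma>)"

lemma push_closed: "slot_inj m n \<sigma> \<Longrightarrow> f \<in> carrier (FT m) \<Longrightarrow> push m n \<sigma> f \<in> carrier (FT n)"
  by (rule push_forward_FT_closed) (rule tuple_embed_closed)

text \<open>Both sides are bilinear, and on pure tuples the claim is
  \<open>tuple_embed_mult\<close>.\<close>

lemma push_mult:
  assumes \<sigma>: "slot_inj m n \<sigma>" and f: "f \<in> carrier (FT m)" and g: "g \<in> carrier (FT m)"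
  shows "push m n \<sigma> (f \<otimes>\<^bsub>FT m\<^esub> g) = push m n \<sigma> f \<otimes>\<^bsub>FT n\<^esub> push m n \<sigma> g"
  using f
proof (induction rule: FT_induct)
  case x: (single x)
  show ?case
    using g by (induction rule: FT_induct)
      (simp_all add: x \<sigma> FT_single_mult FT_single_closed push_forward_single tuple_embed_mult
        tuple_embed_closed FT.r_distr FT.smult_mult_right push_closed
        push_forward_FT_add[where n = n] push_forward_FT_smult[where n = n])
qed (simp_all add: g \<sigma> FT.l_distr FT.smult_mult_left push_closed
    push_forward_FT_add[where n = n] push_forward_FT_smult[where n = n])

lemma push_commute:
  assumes \<sigma>: "slot_inj l n \<sigma>" and \<tau>: "slot_inj m n \<tau>" and disj: "\<sigma> ` {1..l} \<inter> \<tau> ` {1..m} = {}"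
    and f: "f \<in> carrier (FT l)" and g: "g \<in> carrier (FT m)"
  shows "push l n \<sigma> f \<otimes>\<^bsub>FT n\<^esub> push m n \<tau> g = push m n \<tau> g \<otimes>\<^bsub>FT n\<^esub> push l n \<sigma> f"
  using f
proof (induction rule: FT_induct)
  case x: (single x)
  note linear = FT.l_distr FT.r_distr FT.smult_mult_left FT.smult_mult_right push_closed
    push_forward_FT_add[where n = n] push_forward_FT_smult[where n = n]
  show ?case
    using g by (induction rule: FT_induct)
      (simp_all add: x \<sigma> \<tau> linear FT_single_mult FT_single_closed push_forward_single
        tuple_embed_commute[OF \<sigma> \<tau> disj] tuple_embed_closed)
qed (simp_all add: g \<sigma> \<tau> FT.l_distr FT.r_distr FT.smult_mult_left FT.smult_mult_right push_closed
    push_forward_FT_add[where n = n] push_forward_FT_smult[where n = n])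

lemma push_forward_comp:
  assumes "\<And>x. x \<in> tuples M m \<Longrightarrow> \<theta> x = \<psi> (\<phi> x)" "f \<in> carrier (FT m)"
  shows "push_forward R \<theta> f = push_forward R \<psi> (push_forward R \<phi> f)"
  using assms(2)
  by (induction rule: FT_induct)
    (simp_all add: assms(1) push_forward_single FT_add FT_smult push_forward_add push_forward_smult
      FT_fin_supp fin_supp_push_forward)

lemma push_forward_ident:
  assumes "\<And>x. x \<in> tuples M n \<Longrightarrow> \<phi> x = x" "f \<in> carrier (FT n)"
  shows "push_forward R \<phi> f = f"
  using assms(2)
  by (induction rule: FT_induct)
    (simp_all add: assms(1) push_forward_single FT_add FT_smult push_forward_add push_forward_smult
      FT_fin_supp)

lemma push_ideal:
  assumes \<sigma>: "slot_inj m n \<sigma>" and r: "r \<in> TI m"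
  shows "push m n \<sigma> r \<in> TI n"
  by (rule tensor_ideal_image[where h = "push m n \<sigma>" and m = m and \<phi> = "tuple_embed M m n \<sigma>" and s = \<sigma> and g = "\<lambda>i x a. a"])
    (use \<sigma> r in \<open>simp_all add: push_closed push_forward_single tuple_embed_closed tuple_embed_upd slot_inj_at[unfolded One_nat_def]
      push_forward_FT_add[where n = n] push_forward_FT_smult[where n = n] del: atLeastAtMost_iff\<close>)

text \<open>All representatives of a class are supported on tuples. This is how legs and flips,
  given by formulas of their own, are recognised as instances of
  \<open>tensor_embed\<close>.\<close>

lemma tensor_map_cong:
  assumes "\<And>x. x \<in> tuples M m \<Longrightarrow> \<phi> x = \<psi> x"
  shows "tensor_map R M m n \<phi> = tensor_map R M m n \<psi>"
proof -
  have "push_forward R \<phi> f = push_forward R \<psi> f" if X: "X \<in> carrier (TP m)" and f: "f \<in> X" for X f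
  proof (rule push_forward_FT_cong[OF assms])
    obtain g where g: "g \<in> carrier (FT m)" "X = tclass m g" using X by (rule TP_cases)
    then show "f \<in> carrier (FT m)" using f tensor_ideal_closed by (auto simp: tclass_iff)
  qed
  then show ?thesis unfolding tensor_map_def by (intro restrict_ext SUP_cong) auto
qed

lemma tensor_embed_tclass:
  assumes \<sigma>: "slot_inj m n \<sigma>" and f: "f \<in> carrier (FT m)"
  shows "tensor_embed R M m n \<sigma> (tclass m f) = tclass n (push m n \<sigma> f)"
proof -
  have "tensor_embed R M m n \<sigma> (tclass m f) = (\<Union>g\<in>tclass m f. tclass n (push m n \<sigma> g))"
    using tclass_closed[OF f] by (simp add: tensor_embed_def tensor_map_def tclass_def)
  also have "\<dots> = tclass n (push m n \<sigma> f)"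
  proof (rule tclass_UN[OF f])
    fix r assume r: "r \<in> TI m"
    then have "push m n \<sigma> (r \<oplus>\<^bsub>FT m\<^esub> f) = push m n \<sigma> r \<oplus>\<^bsub>FT n\<^esub> push m n \<sigma> f"
      using f tensor_ideal_closed by (intro push_forward_FT_add) auto
    then show "tclass n (push m n \<sigma> (r \<oplus>\<^bsub>FT m\<^esub> f)) = tclass n (push m n \<sigma> f)"
      using push_ideal[OF \<sigma> r] push_closed[OF \<sigma> f] by (simp add: tclass_shift)
  qed
  finally show ?thesis .
qed

lemma tensor_embed_closed:
  "slot_inj m n \<sigma> \<Longrightarrow> X \<in> carrier (TP m) \<Longrightarrow> tensor_embed R M m n \<sigma> X \<in> carrier (TP n)"
  by (auto elim!: TP_cases simp: tensor_embed_tclass tclass_closed push_closed)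

lemma tensor_embed_add:
  assumes \<sigma>: "slot_inj m n \<sigma>" and X: "X \<in> carrier (TP m)" and Y: "Y \<in> carrier (TP m)"
  shows "tensor_embed R M m n \<sigma> (X \<oplus>\<^bsub>TP m\<^esub> Y) =
    tensor_embed R M m n \<sigma> X \<oplus>\<^bsub>TP n\<^esub> tensor_embed R M m n \<sigma> Y"
  using X Y by (auto elim!: TP_cases simp: \<sigma> TP_simps tensor_embed_tclass push_closed
      push_forward_FT_add[where n = n])

lemma tensor_embed_smult:
  assumes \<sigma>: "slot_inj m n \<sigma>" and c: "c \<in> carrier R" and X: "X \<in> carrier (TP m)"
  shows "tensor_embed R M m n \<sigma> (c \<odot>\<^bsub>TP m\<^esub> X) = c \<odot>\<^bsub>TP n\<^esub> tensor_embed R M m n \<sigma> X"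
  using X by (auto elim!: TP_cases simp: \<sigma> c TP_simps tensor_embed_tclass push_closed
      push_forward_FT_smult[where n = n])

lemma tensor_embed_mult:
  assumes \<sigma>: "slot_inj m n \<sigma>" and X: "X \<in> carrier (TP m)" and Y: "Y \<in> carrier (TP m)"
  shows "tensor_embed R M m n \<sigma> (X \<otimes>\<^bsub>TP m\<^esub> Y) =
    tensor_embed R M m n \<sigma> X \<otimes>\<^bsub>TP n\<^esub> tensor_embed R M m n \<sigma> Y"
  using X Y by (auto elim!: TP_cases simp: \<sigma> TP_simps tensor_embed_tclass push_closed push_mult)

lemma tensor_embed_one:
  assumes \<sigma>: "slot_inj m n \<sigma>"
  shows "tensor_embed R M m n \<sigma> \<one>\<^bsub>TP m\<^esub> = \<one>\<^bsub>TP n\<^esub>"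
proof -
  have "push m n \<sigma> \<one>\<^bsub>FT m\<^esub> = \<one>\<^bsub>FT n\<^esub>"
    by (simp add: FT_one push_forward_single tuple_embed_one[OF \<sigma>])
  then show ?thesis by (simp add: TP_one tensor_embed_tclass[OF \<sigma>])
qed

lemma tensor_embed_comp:
  assumes \<sigma>: "slot_inj m n \<sigma>" and \<tau>: "slot_inj n l \<tau>" and X: "X \<in> carrier (TP m)"
  shows "tensor_embed R M n l \<tau> (tensor_embed R M m n \<sigma> X) = tensor_embed R M m l (\<tau> \<circ> \<sigma>) X"
  using X
proof (rule TP_cases)
  fix f assume f: "f \<in> carrier (FT m)" "X = tclass m f"
  have "push m l (\<tau> \<circ> \<sigma>) f = push n l \<tau> (push m n \<sigma> f)"
    by (rule push_forward_comp[where m = m]) (simp_all only: tuple_embed_comp[OF \<sigma> \<tau>] f)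
  then show ?thesis
    using f(1) unfolding f(2)
    by (simp only: \<sigma> \<tau> tensor_embed_tclass push_closed slot_inj_comp[OF \<sigma> \<tau>])
qed

lemma tensor_embed_id: "X \<in> carrier (TP n) \<Longrightarrow> tensor_embed R M n n id X = X"
  by (auto elim!: TP_cases simp: tensor_embed_tclass[OF slot_inj_id] push_forward_ident[OF tuple_embed_id])

lemma tensor_embed_commute:
  assumes \<sigma>: "slot_inj l n \<sigma>" and \<tau>: "slot_inj m n \<tau>" and disj: "\<sigma> ` {1..l} \<inter> \<tau> ` {1..m} = {}"
    and X: "X \<in> carrier (TP l)" and Y: "Y \<in> carrier (TP m)"
  shows "tensor_embed R M l n \<sigma> X \<otimes>\<^bsub>TP n\<^esub> tensor_embed R M m n \<tau> Y =
    tensor_embed R M m n \<tau> Y \<otimes>\<^bsub>TP n\<^esub> tensor_embed R M l n \<sigma> X"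
  using X Y by (auto elim!: TP_cases
      simp: \<sigma> \<tau> TP_simps tensor_embed_tclass push_closed push_commute[OF \<sigma> \<tau> disj])

lemma tensor_embed_extensional: "tensor_embed R M m n \<sigma> \<in> extensional (carrier (TP m))"
  by (simp add: tensor_embed_def tensor_map_def)

lemma tensor_leg_eq:
  assumes "r \<in> {1..n}" "s \<in> {1..n}" "r \<noteq> s"
  shows "tensor_leg R M n r s = tensor_embed R M 2 n (leg_slots r s)"
  unfolding tensor_leg_def tensor_embed_def
proof (rule tensor_map_cong, rule tuple_embed_eqI[symmetric, OF slot_inj_leg[OF assms]])
  fix x assume x: "x \<in> tuples M 2"
  then show "x \<in> tuples M 2" .
  show "(\<lambda>i\<in>{1..n}. if i = r then x 1 else if i = s then x 2 else \<one>\<^bsub>M\<^esub>) \<in> tuples M n"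
    using tuples_closed[OF x, of 1] tuples_closed[OF x, of 2] by (auto simp: tuples_def)
next
  fix x j assume "j \<in> {1..2::nat}"
  then show "(\<lambda>i\<in>{1..n}. if i = r then x 1 else if i = s then x 2 else \<one>\<^bsub>M\<^esub>) (leg_slots r s j) = x j"
    using assms unfolding atLeastAtMost_1_2 by (auto simp: leg_slots_def)
next
  fix x i assume "i \<in> {1..n}" "i \<notin> leg_slots r s ` {1..2}"
  then show "(\<lambda>i\<in>{1..n}. if i = r then x 1 else if i = s then x 2 else \<one>\<^bsub>M\<^esub>) i = \<one>\<^bsub>M\<^esub>"
    unfolding atLeastAtMost_1_2 by (auto simp: leg_slots_def)
qed

text \<open>The flip reads slot \<open>j\<close> from slot \<open>t j\<close>, whereas the embedding
  along \<open>t\<close> moves slot \<open>j\<close> to slot \<open>t j\<close>. The two agree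
  because a transposition \<open>t\<close> is its own inverse.\<close>

lemma tensor_swap_eq:
  assumes "i \<in> {1..<n}"
  shows "tensor_swap R M n i = tensor_embed R M n n (Transposition.transpose i (i + 1))"
  unfolding tensor_swap_def tensor_embed_def
proof (rule tensor_map_cong, rule tuple_embed_eqI[symmetric, OF slot_inj_transpose[OF assms]])
  note t = slot_inj_at[OF slot_inj_transpose[OF assms]]
  fix x assume x: "x \<in> tuples M n"
  then show "x \<in> tuples M n" .
  show "(\<lambda>j\<in>{1..n}. x (Transposition.transpose i (i + 1) j)) \<in> tuples M n"
    unfolding tuples_def using tuples_closed[OF x t] by (intro restrict_PiE_iff[THEN iffD2] ballI)
  fix j assume j: "j \<in> {1..n}"
  show "(\<lambda>j\<in>{1..n}. x (Transposition.transpose i (i + 1) j)) (Transposition.transpose i (i + 1) j) = x j"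
    using t[OF j] by (simp del: atLeastAtMost_iff)
next
  \<comment> \<open>No slot is left to fill: the transposition permutes \<open>{1..n}\<close>, so
    these assumptions are contradictory.\<close>
  fix j assume "j \<in> {1..n}" "j \<notin> Transposition.transpose i (i + 1) ` {1..n}"
  moreover have "Transposition.transpose i (i + 1) ` {1..n} = {1..n}"
    using assms by (intro transpose_image_eq) auto
  ultimately show "(\<lambda>j\<in>{1..n}. x (Transposition.transpose i (i + 1) j)) j = \<one>\<^bsub>M\<^esub>" for x
    by simp
qed

end

section \<open>Automorphism groups of modules\<close>

context module
begin

lemma module_aut_group_carrier:
  "f \<in> carrier (module_aut_group R M) \<longleftrightarrow>
     f \<in> extensional (carrier M) \<and> bij_betw f (carrier M) (carrier M) \<and>
     (\<forall>x\<in>carrier M. \<forall>y\<in>carrier M. f (x \<oplus>\<^bsub>M\<^esub> y) = f x \<oplus>\<^bsub>M\<^esub> f y) \<and>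
     (\<forall>c\<in>carrier R. \<forall>x\<in>carrier M. f (c \<odot>\<^bsub>M\<^esub> x) = c \<odot>\<^bsub>M\<^esub> f x)"
  by (auto simp: module_aut_group_def auto_def hom_def Bij_def dest: bij_betw_imp_funcset)

text \<open>\<open>AutoGroup\<close> takes its operations from \<open>BijGroup\<close>, so it is
  enough to find a subgroup there. Bijectivity and additivity come from
  \<open>subgroup_auto\<close>; only compatibility with scalars remains.\<close>

lemma group_module_aut_group: "group (module_aut_group R M)"
proof -
  let ?H = "carrier (module_aut_group R M)" and ?B = "BijGroup (carrier M)"
  have auto: "subgroup (auto (add_monoid M)) ?B"
    using M.add.subgroup_auto by simp
  have sub: "?H \<subseteq> auto (add_monoid M)" by (auto simp: module_aut_group_def)
  then have Bij: "f \<in> Bij (carrier M)" if "f \<in> ?H" for f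
    using that by (auto simp: auto_def)
  have "subgroup ?H ?B"
  proof (rule subgroup.intro)
    show "?H \<subseteq> carrier ?B" using sub subgroup.subset[OF auto] by blast
    show "\<one>\<^bsub>?B\<^esub> \<in> ?H"
      using subgroup.one_closed[OF auto] by (simp add: module_aut_group_def BijGroup_def)
  next
    fix f g assume fg: "f \<in> ?H" "g \<in> ?H"
    then have "f \<otimes>\<^bsub>?B\<^esub> g \<in> auto (add_monoid M)" using subgroup.m_closed[OF auto] sub by blast
    moreover have "(f \<otimes>\<^bsub>?B\<^esub> g) (c \<odot>\<^bsub>M\<^esub> x) = c \<odot>\<^bsub>M\<^esub> (f \<otimes>\<^bsub>?B\<^esub> g) x"
      if "c \<in> carrier R" "x \<in> carrier M" for c x
      using that fg Bij[OF fg(1)] Bij[OF fg(2)] Bij_imp_funcset[OF Bij[OF fg(2)]]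
      by (auto simp: module_aut_group_carrier BijGroup_def compose_eq Pi_iff)
    ultimately show "f \<otimes>\<^bsub>?B\<^esub> g \<in> ?H" by (simp add: module_aut_group_def)
  next
    fix f assume f: "f \<in> ?H"
    let ?g = "inv\<^bsub>?B\<^esub> f"
    have g: "?g = (\<lambda>x\<in>carrier M. inv_into (carrier M) f x)"
      by (rule inv_BijGroup[OF Bij[OF f]])
    have bij: "bij_betw f (carrier M) (carrier M)" using f by (simp add: module_aut_group_carrier)
    have "?g \<in> auto (add_monoid M)" using subgroup.m_inv_closed[OF auto] sub f by blast
    moreover have "?g (c \<odot>\<^bsub>M\<^esub> x) = c \<odot>\<^bsub>M\<^esub> ?g x" if cx: "c \<in> carrier R" "x \<in> carrier M" for c x
    proof -
      \<comment> \<open>Writing \<open>x\<close> as \<open>f y\<close> turns homogeneity of the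
        inverse into homogeneity of \<open>f\<close>.\<close>
      obtain y where y: "y \<in> carrier M" "x = f y" using bij cx(2) by (auto simp: bij_betw_def)
      then have "c \<odot>\<^bsub>M\<^esub> x = f (c \<odot>\<^bsub>M\<^esub> y)" using f cx by (simp add: module_aut_group_carrier)
      moreover have "f (c \<odot>\<^bsub>M\<^esub> y) \<in> carrier M"
        using bij cx(1) y(1) by (auto simp: bij_betw_def)
      ultimately show ?thesis
        using y cx bij by (simp add: g bij_betw_def inv_into_f_f)
    qed
    ultimately show "?g \<in> ?H" by (simp add: module_aut_group_def)
  qed
  then have "group (?B\<lparr>carrier := ?H\<rparr>)"
    by (rule subgroup.subgroup_is_group[OF _ group_BijGroup])
  then show ?thesis by (simp add: module_aut_group_def AutoGroup_def)
qed

lemma module_aut_groupI: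
  assumes "f \<in> extensional (carrier M)"
    and "\<And>x. x \<in> carrier M \<Longrightarrow> f x \<in> carrier M" "\<And>x. x \<in> carrier M \<Longrightarrow> g x \<in> carrier M"
    and "\<And>x. x \<in> carrier M \<Longrightarrow> g (f x) = x" "\<And>x. x \<in> carrier M \<Longrightarrow> f (g x) = x"
    and "\<And>x y. x \<in> carrier M \<Longrightarrow> y \<in> carrier M \<Longrightarrow> f (x \<oplus>\<^bsub>M\<^esub> y) = f x \<oplus>\<^bsub>M\<^esub> f y"
    and "\<And>c x. c \<in> carrier R \<Longrightarrow> x \<in> carrier M \<Longrightarrow> f (c \<odot>\<^bsub>M\<^esub> x) = c \<odot>\<^bsub>M\<^esub> f x"
  shows "f \<in> carrier (module_aut_group R M)"
  unfolding module_aut_group_carrier using assms by (auto intro!: bij_betwI[where g = g])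

lemma module_aut_group_mult_apply:
  assumes "f \<in> carrier (module_aut_group R M)" "g \<in> carrier (module_aut_group R M)" "x \<in> carrier M"
  shows "(f \<otimes>\<^bsub>module_aut_group R M\<^esub> g) x = f (g x)"
  using assms by (simp add: module_aut_group_def AutoGroup_def BijGroup_def auto_def compose_eq)

lemma module_aut_group_one_apply: "x \<in> carrier M \<Longrightarrow> \<one>\<^bsub>module_aut_group R M\<^esub> x = x"
  by (simp add: module_aut_group_def AutoGroup_def BijGroup_def)

lemma module_aut_group_extensional:
  "f \<in> carrier (module_aut_group R M) \<Longrightarrow> f \<in> extensional (carrier M)"
  by (simp add: module_aut_group_carrier)

lemma module_aut_group_eqI:
  assumes "f \<in> carrier (module_aut_group R M)" "g \<in> extensional (carrier M)"
    and "\<And>x. x \<in> carrier M \<Longrightarrow> f x = g x"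
  shows "f = g"
  by (rule extensionalityI[of _ "carrier M"]) (use assms in \<open>auto simp: module_aut_group_carrier\<close>)

end

section \<open>The representation\<close>

definition vb_rep ::
    "('k, 'r) ring_scheme \<Rightarrow> ('k, 'a, 'm) module_scheme \<Rightarrow> nat \<Rightarrow> ((nat \<Rightarrow> 'a) \<Rightarrow> 'k) set \<Rightarrow>
     vb_gen \<Rightarrow> ((nat \<Rightarrow> 'a) \<Rightarrow> 'k) set \<Rightarrow> ((nat \<Rightarrow> 'a) \<Rightarrow> 'k) set" where
  "vb_rep k A n \<rho> g = (case g of Mu i j \<Rightarrow> leg_mult k A n \<rho> i j | V i \<Rightarrow> tensor_swap k A n i)"

lemma v_perm_Nil: "v_perm [] = id"
  by (simp add: v_perm_def)

lemma v_perm_Cons: "v_perm (i # ws) = Transposition.transpose i (i + 1) \<circ> v_perm ws"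
  by (simp add: v_perm_def)

lemma slot_inj_v_perm: "ws \<in> lists {1..<n} \<Longrightarrow> slot_inj n n (v_perm ws)"
proof (induction ws)
  case (Cons i ws)
  then have "slot_inj n n (Transposition.transpose i (i + 1))" "slot_inj n n (v_perm ws)"
    by (simp_all add: slot_inj_transpose del: add_Suc_right One_nat_def)
  then show ?case unfolding v_perm_Cons by (intro slot_inj_comp)
qed (simp add: v_perm_Nil slot_inj_id)

lemma v_word_in_lists: "ws \<in> lists {1..<n} \<Longrightarrow> v_word ws \<in> lists (vb_gens n \<times> UNIV)"
  by (induction ws) (auto simp: v_word_def gen_def vb_gens_def)

lemma leg_slots_comp: "\<tau> \<circ> leg_slots i j = leg_slots (\<tau> i) (\<tau> j)"
  by (auto simp: leg_slots_def)

context algebra_tensor_powers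
begin

abbreviation Aut :: "nat \<Rightarrow> (((nat \<Rightarrow> 'c) \<Rightarrow> 'a) set \<Rightarrow> ((nat \<Rightarrow> 'c) \<Rightarrow> 'a) set) monoid" where
  "Aut n \<equiv> module_aut_group R (TP n)"

section \<open>The action of the generators and of words in the flips\<close>

lemma tensor_swap_aut:
  assumes i: "i \<in> {1..<n}"
  shows "tensor_swap R M n i \<in> carrier (Aut n)"
proof -
  define t where "t = Transposition.transpose i (i + 1)"
  have t: "slot_inj n n t" unfolding t_def by (rule slot_inj_transpose[OF i])
  have "t \<circ> t = id" by (simp add: t_def)
  then have "tensor_embed R M n n t (tensor_embed R M n n t X) = X" if "X \<in> carrier (TP n)" for X
    using that tensor_embed_comp[OF t t] tensor_embed_id by metis
  then show ?thesis
    unfolding tensor_swap_eq[OF i] t_def[symmetric]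
    by (intro TP.module_aut_groupI[where g = "tensor_embed R M n n t"])
      (simp_all add: tensor_embed_extensional tensor_embed_closed[OF t] tensor_embed_add[OF t]
        tensor_embed_smult[OF t])
qed

text \<open>The embedding preserves products and the unit, so it carries an inverse of
  \<open>\<rho>\<close> to an inverse of the leg; left multiplication by that is the inverse map.
  Left multiplication is in general only linear, not multiplicative, hence automorphisms of the
  module.\<close>

lemma leg_mult_aut:
  assumes ij: "i \<in> {1..n}" "j \<in> {1..n}" "i \<noteq> j" and \<rho>: "\<rho> \<in> Units (TP 2)"
  shows "leg_mult R M n \<rho> i j \<in> carrier (Aut n)"
proof -
  obtain \<rho>' where \<rho>': "\<rho> \<in> carrier (TP 2)" "\<rho>' \<in> carrier (TP 2)"
      "\<rho> \<otimes>\<^bsub>TP 2\<^esub> \<rho>' = \<one>\<^bsub>TP 2\<^esub>" "\<rho>' \<otimes>\<^bsub>TP 2\<^esub> \<rho> = \<one>\<^bsub>TP 2\<^esub>"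
    using \<rho> by (auto simp: Units_def)
  note s = slot_inj_leg[OF ij]
  let ?E = "tensor_embed R M 2 n (leg_slots i j)"
  have closed: "?E \<rho> \<in> carrier (TP n)" "?E \<rho>' \<in> carrier (TP n)"
    by (intro tensor_embed_closed[OF s] \<rho>')+
  have inv: "?E \<rho> \<otimes>\<^bsub>TP n\<^esub> ?E \<rho>' = \<one>\<^bsub>TP n\<^esub>" "?E \<rho>' \<otimes>\<^bsub>TP n\<^esub> ?E \<rho> = \<one>\<^bsub>TP n\<^esub>"
    using tensor_embed_mult[OF s \<rho>'(1,2)] tensor_embed_mult[OF s \<rho>'(2,1)] \<rho>'(3,4)
    by (simp_all add: tensor_embed_one[OF s])
  show ?thesis
  proof (rule TP.module_aut_groupI[where g = "\<lambda>X. ?E \<rho>' \<otimes>\<^bsub>TP n\<^esub> X"])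
    show "leg_mult R M n \<rho> i j \<in> extensional (carrier (TP n))" by (simp add: leg_mult_def)
  qed (simp_all add: leg_mult_def tensor_leg_eq[OF ij] closed TP.r_distr TP.smult_mult_right inv
      flip: TP.m_assoc)
qed

lemma vb_rep_aut:
  assumes "\<rho> \<in> Units (TP 2)"
  shows "vb_rep R M n \<rho> \<in> vb_gens n \<rightarrow> carrier (Aut n)"
  unfolding vb_gens_def vb_rep_def using leg_mult_aut[OF _ _ _ assms] tensor_swap_aut
  by (fastforce split: vb_gen.split)

text \<open>A letter put in front composes on the left, both in \<open>v_perm\<close> and in
  \<open>Aut n\<close>, which is the order in \<open>tensor_embed_comp\<close>. Hence words with the
  same permutation act alike.\<close>

lemma eval_v_word:
  assumes \<rho>: "\<rho> \<in> Units (TP 2)" and ws: "ws \<in> lists {1..<n}"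
  shows "eval_word (Aut n) (vb_rep R M n \<rho>) (v_word ws) = tensor_embed R M n n (v_perm ws)"
proof -
  interpret Aut: group "Aut n" by (rule TP.group_module_aut_group)
  note h = vb_rep_aut[OF \<rho>, of n]
  show ?thesis
    using ws
  proof (induction ws)
    case Nil
    show ?case
    proof (rule TP.module_aut_group_eqI)
      show "eval_word (Aut n) (vb_rep R M n \<rho>) (v_word []) X = tensor_embed R M n n (v_perm []) X"
        if "X \<in> carrier (TP n)" for X
        using that
        by (simp add: v_word_def v_perm_Nil TP.module_aut_group_one_apply tensor_embed_id del: id_apply)
    qed (simp_all add: v_word_def tensor_embed_extensional)
  next
    case (Cons i ws)
    then have i: "i \<in> {1..<n}" and ws: "ws \<in> lists {1..<n}"
      and IH: "eval_word (Aut n) (vb_rep R M n \<rho>) (v_word ws) = tensor_embed R M n n (v_perm ws)"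
      by auto
    have closed: "tensor_embed R M n n (v_perm ws) \<in> carrier (Aut n)"
      unfolding IH[symmetric] by (rule Aut.eval_word_closed[OF h v_word_in_lists[OF ws]])
    have eval: "eval_word (Aut n) (vb_rep R M n \<rho>) (v_word (i # ws)) =
        tensor_swap R M n i \<otimes>\<^bsub>Aut n\<^esub> tensor_embed R M n n (v_perm ws)"
      using IH by (simp add: v_word_def gen_def vb_rep_def)
    note swap = tensor_swap_aut[OF i]
    show ?case
      unfolding eval
    proof (rule TP.module_aut_group_eqI)
      fix X assume X: "X \<in> carrier (TP n)"
      then show "(tensor_swap R M n i \<otimes>\<^bsub>Aut n\<^esub> tensor_embed R M n n (v_perm ws)) X =
          tensor_embed R M n n (v_perm (i # ws)) X"
        unfolding v_perm_Cons TP.module_aut_group_mult_apply[OF swap closed X]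
        unfolding tensor_swap_eq[OF i]
        by (rule tensor_embed_comp[OF slot_inj_v_perm[OF ws] slot_inj_transpose[OF i]])
    qed (simp_all add: swap closed tensor_embed_extensional)
  qed
qed

text \<open>Functoriality together with \<open>leg_slots_comp\<close>. It is applied to permutations
  for the conjugation relations and to the inclusion of three slots for the Yang-Baxter
  equation.\<close>

lemma tensor_embed_leg:
  assumes \<rho>: "\<rho> \<in> carrier (TP 2)" and ij: "i \<in> {1..m}" "j \<in> {1..m}" "i \<noteq> j"
    and \<sigma>: "slot_inj m n \<sigma>"
  shows "tensor_embed R M m n \<sigma> (tensor_leg R M m i j \<rho>) = tensor_leg R M n (\<sigma> i) (\<sigma> j) \<rho>"
proof -
  have "\<sigma> i \<noteq> \<sigma> j" using \<sigma> ij unfolding slot_inj_def by (blast dest: inj_onD)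
  then show ?thesis
    using tensor_leg_eq[OF slot_inj_at[OF \<sigma> ij(1)] slot_inj_at[OF \<sigma> ij(2)]]
    unfolding tensor_leg_eq[OF ij] tensor_embed_comp[OF slot_inj_leg[OF ij] \<sigma> \<rho>] leg_slots_comp
    by simp
qed

lemma tensor_leg_closed:
  "\<rho> \<in> carrier (TP 2) \<Longrightarrow> i \<in> {1..n} \<Longrightarrow> j \<in> {1..n} \<Longrightarrow> i \<noteq> j \<Longrightarrow>
    tensor_leg R M n i j \<rho> \<in> carrier (TP n)"
  by (metis tensor_leg_eq tensor_embed_closed slot_inj_leg)

lemma algebraic_YBE_tensor_power:
  assumes \<rho>: "\<rho> \<in> carrier (TP 2)" and YBE: "algebraic_YBE R M \<rho>" and n: "n \<ge> 3"
  shows "tensor_leg R M n 1 2 \<rho> \<otimes>\<^bsub>TP n\<^esub> tensor_leg R M n 1 3 \<rho> \<otimes>\<^bsub>TP n\<^esub> tensor_leg R M n 2 3 \<rho> =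
    tensor_leg R M n 2 3 \<rho> \<otimes>\<^bsub>TP n\<^esub> tensor_leg R M n 1 3 \<rho> \<otimes>\<^bsub>TP n\<^esub> tensor_leg R M n 1 2 \<rho>"
proof -
  \<comment> \<open>As a slot map from 3 to \<open>n\<close>, \<open>id\<close> is the inclusion: it
    keeps the labels 1, 2, 3 and fills the slots from 4 on with one.\<close>
  have id: "slot_inj 3 n id" using n by (auto simp: slot_inj_def)
  let ?l = "\<lambda>r s. tensor_leg R M 3 r s \<rho>"
  have closed: "?l 1 2 \<in> carrier (TP 3)" "?l 1 3 \<in> carrier (TP 3)" "?l 2 3 \<in> carrier (TP 3)"
    by (auto intro: tensor_leg_closed[OF \<rho>])
  have leg: "tensor_embed R M 3 n id (?l 1 2) = tensor_leg R M n 1 2 \<rho>"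
      "tensor_embed R M 3 n id (?l 1 3) = tensor_leg R M n 1 3 \<rho>"
      "tensor_embed R M 3 n id (?l 2 3) = tensor_leg R M n 2 3 \<rho>"
    by (simp_all add: tensor_embed_leg[OF \<rho> _ _ _ id])
  have "?l 1 2 \<otimes>\<^bsub>TP 3\<^esub> ?l 1 3 \<otimes>\<^bsub>TP 3\<^esub> ?l 2 3 = ?l 2 3 \<otimes>\<^bsub>TP 3\<^esub> ?l 1 3 \<otimes>\<^bsub>TP 3\<^esub> ?l 1 2"
    using YBE unfolding algebraic_YBE_def Let_def .
  then have "tensor_embed R M 3 n id (?l 1 2 \<otimes>\<^bsub>TP 3\<^esub> ?l 1 3 \<otimes>\<^bsub>TP 3\<^esub> ?l 2 3) =
      tensor_embed R M 3 n id (?l 2 3 \<otimes>\<^bsub>TP 3\<^esub> ?l 1 3 \<otimes>\<^bsub>TP 3\<^esub> ?l 1 2)"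
    by (rule arg_cong)
  then show ?thesis by (simp only: tensor_embed_mult[OF id] closed TP.m_closed leg)
qed

lemma vb_rep_conj:
  assumes \<rho>: "\<rho> \<in> Units (TP 2)" and ws: "ws \<in> lists {1..<n}"
    and ij: "i \<in> {1..n}" "j \<in> {1..n}" "i \<noteq> j"
  shows "eval_word (Aut n) (vb_rep R M n \<rho>) (v_word ws @ [gen (Mu i j)] @ inv_word (v_word ws)) =
    eval_word (Aut n) (vb_rep R M n \<rho>) [gen (Mu (v_perm ws i) (v_perm ws j))]"
proof -
  interpret Aut: group "Aut n" by (rule TP.group_module_aut_group)
  note h = vb_rep_aut[OF \<rho>, of n] and lists = v_word_in_lists[OF ws]
  let ?\<tau> = "v_perm ws"
  let ?P = "tensor_embed R M n n ?\<tau>" and ?m = "leg_mult R M n \<rho> i j"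
    and ?m' = "leg_mult R M n \<rho> (?\<tau> i) (?\<tau> j)"
  note \<tau> = slot_inj_v_perm[OF ws]
  have \<tau>ij: "?\<tau> i \<in> {1..n}" "?\<tau> j \<in> {1..n}" using slot_inj_at[OF \<tau>] ij by blast+
  have neq: "?\<tau> i \<noteq> ?\<tau> j" using \<tau> ij unfolding slot_inj_def by (blast dest: inj_onD)
  have \<rho>c: "\<rho> \<in> carrier (TP 2)" using \<rho> by (auto simp: Units_def)
  have P: "?P \<in> carrier (Aut n)"
    using Aut.eval_word_closed[OF h lists] by (simp add: eval_v_word[OF \<rho> ws])
  note m = leg_mult_aut[OF ij \<rho>] and m' = leg_mult_aut[OF \<tau>ij neq \<rho>]
  \<comment> \<open>The intertwining form of the relation, free of inverses: \<open>?P\<close> is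
    multiplicative and relabels the leg. Multiplying by the inverse of \<open>?P\<close> on the
    right then gives the conjugation.\<close>
  have eq: "?P \<otimes>\<^bsub>Aut n\<^esub> ?m = ?m' \<otimes>\<^bsub>Aut n\<^esub> ?P"
  proof (rule TP.module_aut_group_eqI)
    fix X assume X: "X \<in> carrier (TP n)"
    have "?P (tensor_leg R M n i j \<rho> \<otimes>\<^bsub>TP n\<^esub> X) = tensor_leg R M n (?\<tau> i) (?\<tau> j) \<rho> \<otimes>\<^bsub>TP n\<^esub> ?P X"
      by (simp only: tensor_embed_mult[OF \<tau> tensor_leg_closed[OF \<rho>c ij] X] tensor_embed_leg[OF \<rho>c ij \<tau>])
    then show "(?P \<otimes>\<^bsub>Aut n\<^esub> ?m) X = (?m' \<otimes>\<^bsub>Aut n\<^esub> ?P) X"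
      using X tensor_embed_closed[OF \<tau> X]
      unfolding TP.module_aut_group_mult_apply[OF P m X] TP.module_aut_group_mult_apply[OF m' P X]
      by (simp add: leg_mult_def)
  qed (intro TP.module_aut_group_extensional Aut.m_closed P m m')+
  have "eval_word (Aut n) (vb_rep R M n \<rho>) (v_word ws @ [gen (Mu i j)] @ inv_word (v_word ws)) =
      ?P \<otimes>\<^bsub>Aut n\<^esub> (?m \<otimes>\<^bsub>Aut n\<^esub> inv\<^bsub>Aut n\<^esub> ?P)"
  proof -
    have mu: "[gen (Mu i j)] \<in> lists (vb_gens n \<times> UNIV)"
      using ij by (auto simp: gen_def vb_gens_def)
    have "[gen (Mu i j)] @ inv_word (v_word ws) \<in> lists (vb_gens n \<times> UNIV)"
      using mu inv_word_in_lists[OF lists] by simp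
    then show ?thesis
      using m by (simp only: Aut.eval_word_append[OF h lists] Aut.eval_word_append[OF h mu]
          inv_word_in_lists[OF lists] Aut.eval_word_inv_word[OF h lists] eval_v_word[OF \<rho> ws])
        (simp add: gen_def vb_rep_def)
  qed
  also have "\<dots> = (?m' \<otimes>\<^bsub>Aut n\<^esub> ?P) \<otimes>\<^bsub>Aut n\<^esub> inv\<^bsub>Aut n\<^esub> ?P"
    using P m by (simp add: Aut.m_assoc flip: eq)
  also have "\<dots> = ?m'" using P m' by (simp add: Aut.m_assoc)
  finally show ?thesis using m' by (simp add: gen_def vb_rep_def)
qed

lemma vb_rep_rels:
  assumes \<rho>: "\<rho> \<in> Units (TP 2)" and YBE: "algebraic_YBE R M \<rho>"
    and uv: "(u, v) \<in> vb_rels n"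
  shows "eval_word (Aut n) (vb_rep R M n \<rho>) u = eval_word (Aut n) (vb_rep R M n \<rho>) v"
proof -
  interpret Aut: group "Aut n" by (rule TP.group_module_aut_group)
  let ?ev = "eval_word (Aut n) (vb_rep R M n \<rho>)" and ?leg = "\<lambda>i j. tensor_leg R M n i j \<rho>"
  have v_rel: "?ev (v_word ws) = ?ev (v_word ws')"
    if "ws \<in> lists {1..<n}" "ws' \<in> lists {1..<n}" "v_perm ws = v_perm ws'" for ws ws'
    using that by (simp add: eval_v_word[OF \<rho>])
  have \<rho>c: "\<rho> \<in> carrier (TP 2)" using \<rho> by (auto simp: Units_def)
  have aut: "leg_mult R M n \<rho> i j \<in> carrier (Aut n)" "?leg i j \<in> carrier (TP n)"
    if "i \<in> {1..n}" "j \<in> {1..n}" "i \<noteq> j" for i j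
    using that leg_mult_aut[OF _ _ _ \<rho>] tensor_leg_closed[OF \<rho>c] by auto
  \<comment> \<open>The relations among the \<open>V i\<close> are recast through
    \<open>v_word\<close>, so that \<open>v_rel\<close> reduces each of them to an identity of
    permutations.\<close>
  consider
      (braid) i where "1 \<le> i" "i + 1 < n" "u = v_word [i, i + 1, i]" "v = v_word [i + 1, i, i + 1]"
    | (far) i j where "i \<in> {1..<n}" "j \<in> {1..<n}" "\<bar>int i - int j\<bar> > 1" "u = v_word [i, j]" "v = v_word [j, i]"
    | (invol) i where "i \<in> {1..<n}" "u = v_word [i, i]" "v = v_word []"
    | (conj) ws i j where "ws \<in> lists {1..<n}" "i \<in> {1..n}" "j \<in> {1..n}" "i \<noteq> j"
        "u = v_word ws @ [gen (Mu i j)] @ inv_word (v_word ws)" "v = [gen (Mu (v_perm ws i) (v_perm ws j))]"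
    | (ybe) "n \<ge> 3" "u = [gen (Mu 1 2), gen (Mu 1 3), gen (Mu 2 3)]" "v = [gen (Mu 2 3), gen (Mu 1 3), gen (Mu 1 2)]"
    | (comm) "n \<ge> 4" "u = [gen (Mu 1 2), gen (Mu 3 4)]" "v = [gen (Mu 3 4), gen (Mu 1 2)]"
    using uv unfolding vb_rels_def v_word_def by (auto split: if_splits)
  then show ?thesis
  proof cases
    case braid
    have "v_perm [i, i + 1, i] = v_perm [i + 1, i, i + 1]"
      by (rule ext) (auto simp: v_perm_def Transposition.transpose_def)
    then show ?thesis unfolding braid(3,4) using braid(1,2) by (intro v_rel) auto
  next
    case far
    have "v_perm [i, j] = v_perm [j, i]"
      using far(3) by (intro ext) (auto simp: v_perm_def Transposition.transpose_def)
    then show ?thesis unfolding far(4,5) using far(1,2) by (intro v_rel) auto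
  next
    case invol
    have "v_perm [i, i] = v_perm []"
      by (rule ext) (auto simp: v_perm_def)
    then show ?thesis unfolding invol(2,3) using invol(1) by (intro v_rel) auto
  next
    case conj
    then show ?thesis using vb_rep_conj[OF \<rho> conj(1-4)] by simp
  next
    case ybe
    note aut' = aut[of 1 2] aut[of 1 3] aut[of 2 3]
    \<comment> \<open>Composing left multiplications multiplies the factors in the same order, so
      this is the Yang-Baxter equation applied to a tensor. The bracketing is the one that
      \<open>eval_word\<close> produces.\<close>
    have "(leg_mult R M n \<rho> 1 2 \<otimes>\<^bsub>Aut n\<^esub> (leg_mult R M n \<rho> 1 3 \<otimes>\<^bsub>Aut n\<^esub> leg_mult R M n \<rho> 2 3)) =
        (leg_mult R M n \<rho> 2 3 \<otimes>\<^bsub>Aut n\<^esub> (leg_mult R M n \<rho> 1 3 \<otimes>\<^bsub>Aut n\<^esub> leg_mult R M n \<rho> 1 2))"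
    proof (rule TP.module_aut_group_eqI)
      fix X assume X: "X \<in> carrier (TP n)"
      have "?leg 1 2 \<otimes>\<^bsub>TP n\<^esub> ?leg 1 3 \<otimes>\<^bsub>TP n\<^esub> ?leg 2 3 \<otimes>\<^bsub>TP n\<^esub> X =
          ?leg 2 3 \<otimes>\<^bsub>TP n\<^esub> ?leg 1 3 \<otimes>\<^bsub>TP n\<^esub> ?leg 1 2 \<otimes>\<^bsub>TP n\<^esub> X"
        using algebraic_YBE_tensor_power[OF \<rho>c YBE ybe(1)] by simp
      then show "(leg_mult R M n \<rho> 1 2 \<otimes>\<^bsub>Aut n\<^esub> (leg_mult R M n \<rho> 1 3 \<otimes>\<^bsub>Aut n\<^esub> leg_mult R M n \<rho> 2 3)) X =
          (leg_mult R M n \<rho> 2 3 \<otimes>\<^bsub>Aut n\<^esub> (leg_mult R M n \<rho> 1 3 \<otimes>\<^bsub>Aut n\<^esub> leg_mult R M n \<rho> 1 2)) X"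
        using aut' X ybe(1)
        by (simp add: TP.module_aut_group_mult_apply) (simp add: leg_mult_def TP.m_assoc)
    qed (use aut' ybe(1) in \<open>simp_all add: TP.module_aut_group_extensional\<close>)
    then show ?thesis using aut' ybe by (simp add: gen_def vb_rep_def)
  next
    case comm
    note aut' = aut[of 1 2] aut[of 3 4]
    have legs: "slot_inj 2 n (leg_slots 1 2)" "slot_inj 2 n (leg_slots 3 4)"
      using comm(1) by (auto intro: slot_inj_leg)
    have leg_eq: "?leg 1 2 = tensor_embed R M 2 n (leg_slots 1 2) \<rho>"
      "?leg 3 4 = tensor_embed R M 2 n (leg_slots 3 4) \<rho>"
      using comm(1) tensor_leg_eq[of 1 n 2] tensor_leg_eq[of 3 n 4] by auto
    have "leg_slots 1 2 ` {1..2} \<inter> leg_slots 3 4 ` {1..2} = {}"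
      by (auto simp: leg_slots_def)
    from tensor_embed_commute[OF legs this \<rho>c \<rho>c]
    have leg_comm: "?leg 1 2 \<otimes>\<^bsub>TP n\<^esub> ?leg 3 4 = ?leg 3 4 \<otimes>\<^bsub>TP n\<^esub> ?leg 1 2"
      unfolding leg_eq .
    have "leg_mult R M n \<rho> 1 2 \<otimes>\<^bsub>Aut n\<^esub> leg_mult R M n \<rho> 3 4 =
        leg_mult R M n \<rho> 3 4 \<otimes>\<^bsub>Aut n\<^esub> leg_mult R M n \<rho> 1 2"
    proof (rule TP.module_aut_group_eqI)
      fix X assume X: "X \<in> carrier (TP n)"
      have "?leg 1 2 \<otimes>\<^bsub>TP n\<^esub> ?leg 3 4 \<otimes>\<^bsub>TP n\<^esub> X = ?leg 3 4 \<otimes>\<^bsub>TP n\<^esub> ?leg 1 2 \<otimes>\<^bsub>TP n\<^esub> X"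
        by (simp only: leg_comm)
      then show "(leg_mult R M n \<rho> 1 2 \<otimes>\<^bsub>Aut n\<^esub> leg_mult R M n \<rho> 3 4) X =
          (leg_mult R M n \<rho> 3 4 \<otimes>\<^bsub>Aut n\<^esub> leg_mult R M n \<rho> 1 2) X"
        using aut' X comm(1)
        by (simp add: TP.module_aut_group_mult_apply) (simp add: leg_mult_def TP.m_assoc)
    qed (use aut' comm(1) in \<open>simp_all add: TP.module_aut_group_extensional\<close>)
    then show ?thesis using aut' comm by (simp add: gen_def vb_rep_def)
  qed
qed

end

theorem proposition3:
  fixes n :: nat
    and k :: "('k, 'r) ring_scheme"
    and A :: "('k, 'a, 'm) module_scheme"
    and \<rho> :: "((nat \<Rightarrow> 'a) \<Rightarrow> 'k) set"
  assumes "n \<ge> 2"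
    and "assoc_algebra k A"
    and "\<rho> \<in> Units (tensor_power k A 2)"
    and "algebraic_YBE k A \<rho>"
  shows "\<exists>!Rep. Rep \<in> extensional (carrier (virtual_braid_group n)) \<and>
           group_hom (virtual_braid_group n) (module_aut_group k (tensor_power k A n)) Rep \<and>
           subgroup (Rep ` carrier (virtual_braid_group n))
             (module_aut_group k (tensor_power k A n)) \<and>
           (\<forall>i\<in>{1..n}. \<forall>j\<in>{1..n}. i \<noteq> j \<longrightarrow> Rep (vb_mu n i j) = leg_mult k A n \<rho> i j) \<and>
           (\<forall>i\<in>{1..<n}. Rep (vb_v n i) = tensor_swap k A n i)"
proof -
  interpret algebra_tensor_powers k A
    using assms(2) by (rule algebra_tensor_powers.intro)
  let ?P = "presented_group (vb_gens n) (vb_rels n)"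
  have "\<exists>!f. f \<in> extensional (carrier ?P) \<and> group_hom ?P (Aut n) f \<and>
      (\<forall>g\<in>vb_gens n. f (word_class (vb_gens n) (vb_rels n) [gen g]) = vb_rep k A n \<rho> g)"
    by (rule group.presented_group_universal[OF TP.group_module_aut_group vb_rep_aut[OF assms(3)]
          vb_rep_rels[OF assms(3,4)]])
  \<comment> \<open>The single condition on all generators splits along the two constructors
    \<open>Mu\<close> and \<open>V\<close>.\<close>
  moreover have "(\<forall>g\<in>vb_gens n. f (word_class (vb_gens n) (vb_rels n) [gen g]) = vb_rep k A n \<rho> g) \<longleftrightarrow>
      (\<forall>i\<in>{1..n}. \<forall>j\<in>{1..n}. i \<noteq> j \<longrightarrow> f (vb_mu n i j) = leg_mult k A n \<rho> i j) \<and>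
      (\<forall>i\<in>{1..<n}. f (vb_v n i) = tensor_swap k A n i)" for f
    by (fastforce simp: vb_gens_def vb_rep_def vb_mu_def vb_v_def)
  \<comment> \<open>The image of a group homomorphism is a subgroup; \<open>conj_cong\<close> lets
    the simplifier use the homomorphism clause to discharge the subgroup clause next to it.\<close>
  ultimately show ?thesis
    unfolding virtual_braid_group_def by (simp add: group_hom.img_is_subgroup cong: conj_cong)
qed

end
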